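(* The numerical solution of the semi-discrete scheme is unique: there is at most one $u_h\in H^1(0,\overline t;V_h^0)$ such that $u_h(0,\cdot)=Q_h\psi$ and $$(u_{h,t},v_0)+(\Delta_w u_h,\Delta_w v)=(f,v_0)\qquad\text{for all } v=\{v_0,v_b,v_n\mathbf n_e\}\in V_h^0 .$$
   Context: Let $\Omega\subset\mathbb R^d$ ($d=2,3$) be a bounded polygonal/polyhedral domain, $\overline t>0$, $f\in L^2(0,\overline t;L^2(\Omega))$, $\psi\in H_0^2(\Omega)$. $(\cdot,\cdot)$, $\|\cdot\|$ denote the $L^2(\Omega)$ inner product and norm (computed elementwise for piecewise functions). $u_{h,t}$ paired with $v_0$ means the time derivative of the interior component of $u_h$; the equation is required for (almost every) $t\in(0,\overline t]$. Mesh: $\mathcal T_h$ is a partition of $\Omega$ into polygons/polyhedra $T$ of diameter $h_T$, $h=\max_T h_T$, with edges/faces $\mathcal E_h$, shape regular in the usual weak Galerkin sense with constants independent of $h$: (A1) $|T|\ge \varrho_v h_T^d$, $|e|\ge\varrho_e h_e^{d-1}$; (A2) $h_e\ge\kappa h_T$ for $e\subset\partial T$; (A3) for every $T$ and $e\subset\partial T$ there is a pyramid in $T$ with base $e$, apex $A_e\in T$, height at least $\sigma_e h_T$, the angle between $x_e-A_e$ and the outward normal being strictly acute for all $x_e\in e$; (A4) each $T$ has a shape regular circumscribed simplex of diameter at most $\gamma_* h_T$ meeting only a fixed bounded number of other such simplices. For each $e\in\mathcal E_h$ fix one unit normal $\mathbf n_e$; $\mathbf n$ is the outward unit normal of $\partial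 T$. Spaces: for an integer $k\ge2$, $V_h=\{v=\{v_0,v_b,v_n\mathbf n_e\}: v_0|_T\in P_k(T),\ v_b|_e\in P_k(e),\ v_n|_e\in P_{k-1}(e)\}$ ($v_b,v_n$ single valued on each $e\in\mathcal E_h$), $V_h^0=\{v\in V_h: v_b|_e=0,\ v_n|_e=0 \text{ for } e\subset\partial\Omega\}$. The weak Laplacian $\Delta_w v|_T\in P_r(T)$ is defined by $(\Delta_w v,\varphi)_T=(v_0,\Delta\varphi)_T-\langle v_b,\nabla\varphi\cdot\mathbf n\rangle_{\partial T}+\langle v_n\mathbf n_e\cdot\mathbf n,\varphi\rangle_{\partial T}$ for all $\varphi\in P_r(T)$. The degree $r$ is taken large enough (depending on $k$ and the mesh regularity) that with $|||v|||^2=(\Delta_w v,\Delta_w v)$ and $\|v\|_{2,h}^2=\sum_T(\|\Delta v_0\|_T^2+h_T^{-3}\|v_0-v_b\|_{\partial T}^2+h_T^{-1}\|(\nabla v_0-v_n\mathbf n_e)\cdot\mathbf n\|_{\partial T}^2)$ one has $C_1\|v\|_{2,h}\le|||v|||\le C_2\|v\|_{2,h}$ for $v\in V_h$, with $C_1,C_2>0$ independent of $h$. Projections: $Q_0,Q_b,Q_n$ are the $L^2$ projections onto $P_k(T)$, $P_k(e)$, $P_{k-1}(e)$; $Q_hu=\{Q_0u,Q_bu,Q_n(\nabla u\cdot\mathbf n_e)\mathbf n_e\}$. *)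

theory Defs
  imports "HOL-Analysis.Analysis" "HOL-Library.Function_Algebras" "HOL-Library.Product_Plus"
begin

text \<open>Finite unions of convex polytopes of one common dimension, in one piece; convexity is not
  required. Cells and closures of domains have dimension \<open>d\<close>, edges/faces dimension \<open>d - 1\<close>
  (the latter are therefore flat).\<close>

definition polyhedral :: "'a::euclidean_space set \<Rightarrow> bool" where
  "polyhedral S \<longleftrightarrow> S \<noteq> {} \<and> connected (rel_interior S) \<and>
     (\<exists>F. finite F \<and> S = \<Union>F \<and> (\<forall>P\<in>F. polytope P \<and> aff_dim P = aff_dim S))"

text \<open>The condition \<open>\<Omega> = interior (closure \<Omega>)\<close> rules out slits.\<close>

definition polyhedral_domain :: "'a::euclidean_space set \<Rightarrow> bool" where
  "polyhedral_domain \<Omega> \<longleftrightarrow> open \<Omega> \<and> connected \<Omega> \<and> bounded \<Omega> \<and> \<Omega> \<noteq> {} \<and>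
     \<Omega> = interior (closure \<Omega>) \<and> polyhedral (closure \<Omega>)"

text \<open>A mesh carries its cells (closed sets), its edges/faces and the chosen unit normal \<open>n\<^sub>e\<close>
  of each edge/face.\<close>

record 'a mesh =
  cells :: "'a set set"
  faces :: "'a set set"
  nrm :: "'a set \<Rightarrow> 'a"

definition is_unit_normal :: "'a::euclidean_space set \<Rightarrow> 'a \<Rightarrow> bool" where
  "is_unit_normal e n \<longleftrightarrow> norm n = 1 \<and> (\<forall>x\<in>e. \<forall>y\<in>e. n \<bullet> (x - y) = 0)"

definition is_outward_normal :: "'a::euclidean_space set \<Rightarrow> 'a set \<Rightarrow> 'a \<Rightarrow> bool" where
  "is_outward_normal T e n \<longleftrightarrow> is_unit_normal e n \<and>
     (\<forall>x\<in>rel_interior e. \<exists>\<epsilon>>0. \<forall>s. 0 < s \<and> s < \<epsilon> \<longrightarrow> x - s *\<^sub>R n \<in> T \<and> x + s *\<^sub>R n \<notin> T)"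

definition outward_normal :: "'a::euclidean_space set \<Rightarrow> 'a set \<Rightarrow> 'a" where
  "outward_normal T e = (THE n. is_outward_normal T e n)"

definition cell_faces :: "'a::euclidean_space mesh \<Rightarrow> 'a set \<Rightarrow> 'a set set" where
  "cell_faces M T = {e \<in> faces M. e \<subseteq> frontier T}"

text \<open>Hanging nodes are allowed: adjacent edges/faces of one cell may be coplanar.\<close>

definition is_mesh :: "'a::euclidean_space set \<Rightarrow> 'a mesh \<Rightarrow> bool" where
  "is_mesh \<Omega> M \<longleftrightarrow>
     finite (cells M) \<and> \<Union>(cells M) = closure \<Omega> \<and>
     (\<forall>T\<in>cells M. polyhedral T \<and> aff_dim T = int DIM('a)) \<and>
     (\<forall>T\<in>cells M. \<forall>T'\<in>cells M. T \<noteq> T' \<longrightarrow> interior T \<inter> interior T' = {}) \<and>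
     finite (faces M) \<and>
     (\<forall>e\<in>faces M. polyhedral e \<and> aff_dim e = int DIM('a) - 1 \<and> is_unit_normal e (nrm M e)) \<and>
     (\<forall>e\<in>faces M. \<forall>e'\<in>faces M. e \<noteq> e' \<longrightarrow> rel_interior e \<inter> rel_interior e' = {}) \<and>
     (\<forall>e\<in>faces M. \<exists>T\<in>cells M. e \<in> cell_faces M T) \<and>
     (\<forall>T\<in>cells M. frontier T = \<Union>(cell_faces M T)) \<and>
     (\<forall>T\<in>cells M. \<forall>e\<in>cell_faces M T. \<exists>n. is_outward_normal T e n)"

text \<open>The \<open>(d-1)\<close>-dimensional Lebesgue measure on a flat set \<open>e\<close> with unit normal \<open>n\<close>: by Fubini, it is
  the image of \<open>d\<close>-dimensional Lebesgue measure on the right prism of height 1 over \<open>e\<close> under the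
  orthogonal projection onto the hyperplane of \<open>e\<close>.\<close>

definition face_measure :: "'a::euclidean_space set \<Rightarrow> 'a \<Rightarrow> 'a measure" where
  "face_measure e n =
     (let y\<^sub>0 = (SOME y. y \<in> e) in
      distr (restrict_space lborel {y + s *\<^sub>R n | y s. y \<in> e \<and> 0 \<le> s \<and> s \<le> 1}) borel
        (\<lambda>x. x - ((x - y\<^sub>0) \<bullet> n) *\<^sub>R n))"

abbreviation fmeas :: "'a::euclidean_space mesh \<Rightarrow> 'a set \<Rightarrow> 'a measure" where
  "fmeas M e \<equiv> face_measure e (nrm M e)"

text \<open>A family of meshes (indexed by \<open>h\<close> in the usual notation) shape regular with constants
  common to all its members. \<open>S T\<close> is the circumscribed simplex of \<open>T\<close>; its own shape regularity is
  measured by the ratio \<open>\<tau>\<close> of the radius of an inscribed ball to the diameter.\<close>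

definition shape_regular_family :: "'a::euclidean_space set \<Rightarrow> 'a mesh set \<Rightarrow> bool" where
  "shape_regular_family \<Omega> MM \<longleftrightarrow>
    (\<exists>\<rho>\<^sub>v>0. \<exists>\<rho>\<^sub>e>0. \<exists>\<kappa>>0. \<exists>\<sigma>>0. \<exists>\<tau>>0. \<exists>\<gamma>>0. \<exists>N::nat. \<forall>M\<in>MM.
       is_mesh \<Omega> M \<and>
       (\<forall>T\<in>cells M. measure lebesgue T \<ge> \<rho>\<^sub>v * diameter T ^ DIM('a)) \<and>
       (\<forall>e\<in>faces M. measure (fmeas M e) UNIV \<ge> \<rho>\<^sub>e * diameter e ^ (DIM('a) - 1)) \<and>
       (\<forall>T\<in>cells M. \<forall>e\<in>cell_faces M T. diameter e \<ge> \<kappa> * diameter T) \<and>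
       \<comment> \<open>the pyramid with base \<open>e\<close> and apex \<open>A\<close>; for \<open>x \<in> e\<close> the height is \<open>(x - A) \<bullet> n\<close>\<close>
       (\<forall>T\<in>cells M. \<forall>e\<in>cell_faces M T. \<exists>A\<in>T.
          {(1 - s) *\<^sub>R A + s *\<^sub>R x | s x. x \<in> e \<and> 0 \<le> s \<and> s \<le> 1} \<subseteq> T \<and>
          (\<forall>x\<in>e. (x - A) \<bullet> outward_normal T e > 0 \<and>
                  (x - A) \<bullet> outward_normal T e \<ge> \<sigma> * diameter T)) \<and>
       (\<exists>S. \<forall>T\<in>cells M.
          int DIM('a) simplex S T \<and> T \<subseteq> S T \<and>
          (\<exists>c. cball c (\<tau> * diameter (S T)) \<subseteq> S T) \<and>
          diameter (S T) \<le> \<gamma> * diameter T \<and>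
          card {T' \<in> cells M. T' \<noteq> T \<and> S T' \<inter> S T \<noteq> {}} \<le> N))"

definition partial :: "'n::finite \<Rightarrow> (real^'n \<Rightarrow> real) \<Rightarrow> real^'n \<Rightarrow> real" where
  "partial i f x = frechet_derivative f (at x) (axis i 1)"

definition grad :: "(real^'n::finite \<Rightarrow> real) \<Rightarrow> real^'n \<Rightarrow> real^'n" where
  "grad f x = (\<chi> i. partial i f x)"

definition laplacian :: "(real^'n::finite \<Rightarrow> real) \<Rightarrow> real^'n \<Rightarrow> real" where
  "laplacian f x = (\<Sum>i\<in>UNIV. partial i (partial i f) x)"

text \<open>\<open>C\<^sup>\<infinity>\<close>: all iterated partial derivatives exist and are Frechet differentiable.\<close>

definition smooth :: "(real^'n::finite \<Rightarrow> real) \<Rightarrow> bool" where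
  "smooth f \<longleftrightarrow> (\<forall>is. foldr partial is f differentiable_on UNIV)"

definition test_functions :: "(real^'n::finite) set \<Rightarrow> (real^'n \<Rightarrow> real) set" where
  "test_functions \<Omega> =
     {\<phi>. smooth \<phi> \<and> compact (closure {x. \<phi> x \<noteq> 0}) \<and> closure {x. \<phi> x \<noteq> 0} \<subseteq> \<Omega>}"

definition L2 :: "'a measure \<Rightarrow> ('a \<Rightarrow> real) set" where
  "L2 m = {f \<in> borel_measurable m. integrable m (\<lambda>x. (f x)\<^sup>2)}"

definition L2_ip :: "'a measure \<Rightarrow> ('a \<Rightarrow> real) \<Rightarrow> ('a \<Rightarrow> real) \<Rightarrow> real" where
  "L2_ip m f g = (LINT x|m. f x * g x)"

definition L2_norm :: "'a measure \<Rightarrow> ('a \<Rightarrow> real) \<Rightarrow> real" where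
  "L2_norm m f = sqrt (LINT x|m. (f x)\<^sup>2)"

definition is_weak_partial ::
    "(real^'n::finite) set \<Rightarrow> 'n \<Rightarrow> (real^'n \<Rightarrow> real) \<Rightarrow> (real^'n \<Rightarrow> real) \<Rightarrow> bool" where
  "is_weak_partial \<Omega> i u w \<longleftrightarrow> w \<in> L2 (lebesgue_on \<Omega>) \<and>
     (\<forall>\<phi>\<in>test_functions \<Omega>.
        L2_ip (lebesgue_on \<Omega>) u (partial i \<phi>) = - L2_ip (lebesgue_on \<Omega>) w \<phi>)"

text \<open>Weak derivatives are determined up to null sets, and nothing below depends on the choice.\<close>

definition weak_partial ::
    "(real^'n::finite) set \<Rightarrow> 'n \<Rightarrow> (real^'n \<Rightarrow> real) \<Rightarrow> real^'n \<Rightarrow> real" where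
  "weak_partial \<Omega> i u = (SOME w. is_weak_partial \<Omega> i u w)"

definition H1 :: "(real^'n::finite) set \<Rightarrow> (real^'n \<Rightarrow> real) set" where
  "H1 \<Omega> = {u \<in> L2 (lebesgue_on \<Omega>). \<forall>i. \<exists>w. is_weak_partial \<Omega> i u w}"

definition H2 :: "(real^'n::finite) set \<Rightarrow> (real^'n \<Rightarrow> real) set" where
  "H2 \<Omega> = {u \<in> H1 \<Omega>. \<forall>i. weak_partial \<Omega> i u \<in> H1 \<Omega>}"

definition H1_norm :: "(real^'n::finite) set \<Rightarrow> (real^'n \<Rightarrow> real) \<Rightarrow> real" where
  "H1_norm \<Omega> u = sqrt ((L2_norm (lebesgue_on \<Omega>) u)\<^sup>2
     + (\<Sum>i\<in>UNIV. (L2_norm (lebesgue_on \<Omega>) (weak_partial \<Omega> i u))\<^sup>2))"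

definition H2_norm :: "(real^'n::finite) set \<Rightarrow> (real^'n \<Rightarrow> real) \<Rightarrow> real" where
  "H2_norm \<Omega> u = sqrt ((L2_norm (lebesgue_on \<Omega>) u)\<^sup>2
     + (\<Sum>i\<in>UNIV. (L2_norm (lebesgue_on \<Omega>) (weak_partial \<Omega> i u))\<^sup>2)
     + (\<Sum>i\<in>UNIV. \<Sum>j\<in>UNIV.
          (L2_norm (lebesgue_on \<Omega>) (weak_partial \<Omega> j (weak_partial \<Omega> i u)))\<^sup>2))"

definition H02 :: "(real^'n::finite) set \<Rightarrow> (real^'n \<Rightarrow> real) set" where
  "H02 \<Omega> = {u \<in> H2 \<Omega>. \<exists>\<phi>::nat \<Rightarrow> real^'n \<Rightarrow> real.
     (\<forall>m. \<phi> m \<in> test_functions \<Omega>) \<and> (\<lambda>m. H2_norm \<Omega> (u - \<phi> m)) \<longlonglongrightarrow> 0}"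

text \<open>The trace on an edge/face with surface measure \<open>m\<close>: the extension by density of the restriction
  of smooth functions, continuous from \<open>H\<^sup>1(\<Omega>)\<close> to \<open>L\<^sup>2(e)\<close>. It is determined up to null sets.\<close>

definition is_trace ::
    "(real^'n::finite) set \<Rightarrow> (real^'n) measure \<Rightarrow> (real^'n \<Rightarrow> real) \<Rightarrow> (real^'n \<Rightarrow> real) \<Rightarrow> bool" where
  "is_trace \<Omega> m u g \<longleftrightarrow> g \<in> L2 m \<and>
     (\<exists>\<phi>::nat \<Rightarrow> real^'n \<Rightarrow> real. (\<forall>j. smooth (\<phi> j)) \<and>
        (\<lambda>j. H1_norm \<Omega> (u - \<phi> j)) \<longlonglongrightarrow> 0 \<and> (\<lambda>j. L2_norm m (g - \<phi> j)) \<longlonglongrightarrow> 0)"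

definition face_trace ::
    "(real^'n::finite) set \<Rightarrow> (real^'n) measure \<Rightarrow> (real^'n \<Rightarrow> real) \<Rightarrow> real^'n \<Rightarrow> real" where
  "face_trace \<Omega> m u = (SOME g. is_trace \<Omega> m u g)"

definition poly_space :: "nat \<Rightarrow> (real^'n::finite \<Rightarrow> real) set" where
  "poly_space k = {p. \<exists>c :: ('n \<Rightarrow> nat) \<Rightarrow> real.
     p = (\<lambda>x. \<Sum>\<alpha> | (\<Sum>i\<in>UNIV. \<alpha> i) \<le> k. c \<alpha> * (\<Prod>i\<in>UNIV. (x $ i) ^ \<alpha> i))}"

text \<open>\<open>poly_space k\<close> on a face: restrictions of polynomials to \<open>e\<close>, extended by \<open>0\<close> off \<open>e\<close> so that equality
  of functions is equality on \<open>e\<close>.\<close>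

definition P_face :: "nat \<Rightarrow> (real^'n::finite) set \<Rightarrow> (real^'n \<Rightarrow> real) set" where
  "P_face k e = {\<lambda>x. if x \<in> e then p x else 0 | p. p \<in> poly_space k}"

text \<open>A triple \<open>(v\<^sub>0, v\<^sub>b, v\<^sub>n)\<close>; \<open>v\<^sub>0\<close> is indexed by cells, \<open>v\<^sub>b\<close> and \<open>v\<^sub>n\<close> by faces. On a cell \<open>T\<close> (which
  has nonempty interior) the polynomial \<open>v\<^sub>0 T\<close> is identified with its extension to the whole space.
  The third component stands for the vector field \<open>v\<^sub>n n\<^sub>e\<close>.\<close>

type_synonym 'a wg = "('a set \<Rightarrow> 'a \<Rightarrow> real) \<times> ('a set \<Rightarrow> 'a \<Rightarrow> real) \<times> ('a set \<Rightarrow> 'a \<Rightarrow> real)"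

definition v0 :: "'a wg \<Rightarrow> 'a set \<Rightarrow> 'a \<Rightarrow> real" where "v0 v = fst v"
definition vb :: "'a wg \<Rightarrow> 'a set \<Rightarrow> 'a \<Rightarrow> real" where "vb v = fst (snd v)"
definition vn :: "'a wg \<Rightarrow> 'a set \<Rightarrow> 'a \<Rightarrow> real" where "vn v = snd (snd v)"

definition Vh :: "(real^'n::finite) mesh \<Rightarrow> nat \<Rightarrow> (real^'n) wg set" where
  "Vh M k = {v.
     (\<forall>T. if T \<in> cells M then v0 v T \<in> poly_space k else v0 v T = 0) \<and>
     (\<forall>e. if e \<in> faces M then vb v e \<in> P_face k e else vb v e = 0) \<and>
     (\<forall>e. if e \<in> faces M then vn v e \<in> P_face (k - 1) e else vn v e = 0)}"

definition Vh0 :: "(real^'n::finite) set \<Rightarrow> (real^'n) mesh \<Rightarrow> nat \<Rightarrow> (real^'n) wg set" where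
  "Vh0 \<Omega> M k = {v \<in> Vh M k. \<forall>e\<in>faces M. e \<subseteq> frontier \<Omega> \<longrightarrow> vb v e = 0 \<and> vn v e = 0}"

definition weak_laplacian ::
    "(real^'n::finite) mesh \<Rightarrow> nat \<Rightarrow> (real^'n) wg \<Rightarrow> (real^'n) set \<Rightarrow> real^'n \<Rightarrow> real" where
  "weak_laplacian M r v T = (THE w. w \<in> poly_space r \<and> (\<forall>\<phi>\<in>poly_space r.
     L2_ip (lebesgue_on T) w \<phi> =
       L2_ip (lebesgue_on T) (v0 v T) (laplacian \<phi>)
       - (\<Sum>e\<in>cell_faces M T. L2_ip (fmeas M e) (vb v e) (\<lambda>x. grad \<phi> x \<bullet> outward_normal T e))
       + (\<Sum>e\<in>cell_faces M T.
            L2_ip (fmeas M e) (\<lambda>x. (vn v e x *\<^sub>R nrm M e) \<bullet> outward_normal T e) \<phi>)))"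

definition wg_form ::
    "(real^'n::finite) mesh \<Rightarrow> nat \<Rightarrow> (real^'n) wg \<Rightarrow> (real^'n) wg \<Rightarrow> real" where
  "wg_form M r u v =
     (\<Sum>T\<in>cells M. L2_ip (lebesgue_on T) (weak_laplacian M r u T) (weak_laplacian M r v T))"

definition energy_norm :: "(real^'n::finite) mesh \<Rightarrow> nat \<Rightarrow> (real^'n) wg \<Rightarrow> real" where
  "energy_norm M r v = sqrt (wg_form M r v v)"

definition norm_2h :: "(real^'n::finite) mesh \<Rightarrow> (real^'n) wg \<Rightarrow> real" where
  "norm_2h M v = sqrt (\<Sum>T\<in>cells M.
     (L2_norm (lebesgue_on T) (laplacian (v0 v T)))\<^sup>2
     + (\<Sum>e\<in>cell_faces M T. (L2_norm (fmeas M e) (\<lambda>x. v0 v T x - vb v e x))\<^sup>2) / diameter T ^ 3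
     + (\<Sum>e\<in>cell_faces M T. (L2_norm (fmeas M e)
          (\<lambda>x. (grad (v0 v T) x - vn v e x *\<^sub>R nrm M e) \<bullet> outward_normal T e))\<^sup>2) / diameter T)"

definition norm_equivalence :: "(real^'n::finite) mesh set \<Rightarrow> nat \<Rightarrow> nat \<Rightarrow> bool" where
  "norm_equivalence MM k r \<longleftrightarrow> (\<exists>C\<^sub>1>0. \<exists>C\<^sub>2>0. \<forall>M\<in>MM. \<forall>v\<in>Vh M k.
     C\<^sub>1 * norm_2h M v \<le> energy_norm M r v \<and> energy_norm M r v \<le> C\<^sub>2 * norm_2h M v)"

definition L2_proj :: "'a measure \<Rightarrow> ('a \<Rightarrow> real) set \<Rightarrow> ('a \<Rightarrow> real) \<Rightarrow> 'a \<Rightarrow> real" where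
  "L2_proj m X g = (THE p. p \<in> X \<and> (\<forall>q\<in>X. L2_ip m p q = L2_ip m g q))"

definition Qh :: "(real^'n::finite) set \<Rightarrow> (real^'n) mesh \<Rightarrow> nat \<Rightarrow> (real^'n \<Rightarrow> real) \<Rightarrow> (real^'n) wg" where
  "Qh \<Omega> M k u =
     ((\<lambda>T. if T \<in> cells M then L2_proj (lebesgue_on T) (poly_space k) u else 0),
      (\<lambda>e. if e \<in> faces M then L2_proj (fmeas M e) (P_face k e) (face_trace \<Omega> (fmeas M e) u) else 0),
      (\<lambda>e. if e \<in> faces M then L2_proj (fmeas M e) (P_face (k - 1) e)
             (\<lambda>x. (\<chi> i. face_trace \<Omega> (fmeas M e) (weak_partial \<Omega> i u) x) \<bullet> nrm M e) else 0))"

text \<open>\<open>L\<^sup>2(0,\<tau>;X)\<close> for a function space \<open>X\<close> with norm \<open>N\<close>: strongly measurable (almost everywhere limits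
  of simple functions) with square integrable norm.\<close>

definition bochner_L2 ::
    "real \<Rightarrow> 'b::ab_group_add set \<Rightarrow> ('b \<Rightarrow> real) \<Rightarrow> (real \<Rightarrow> 'b) \<Rightarrow> bool" where
  "bochner_L2 \<tau> X N u \<longleftrightarrow>
     (AE t in lebesgue_on {0<..<\<tau>}. u t \<in> X) \<and>
     (\<exists>s::nat \<Rightarrow> real \<Rightarrow> 'b. (\<forall>m. simple_function (lebesgue_on {0<..<\<tau>}) (s m)) \<and>
        (\<forall>m. \<forall>t\<in>{0<..<\<tau>}. s m t \<in> X) \<and>
        (AE t in lebesgue_on {0<..<\<tau>}. (\<lambda>m. N (s m t - u t)) \<longlonglongrightarrow> 0)) \<and>
     integrable (lebesgue_on {0<..<\<tau>}) (\<lambda>t. (N (u t))\<^sup>2)"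

text \<open>\<open>V\<^sub>h\<^sup>0\<close> is finite dimensional, so that all its norms are equivalent; we use the \<open>L\<^sup>2\<close> norm.\<close>

definition wg_norm :: "(real^'n::finite) mesh \<Rightarrow> (real^'n) wg \<Rightarrow> real" where
  "wg_norm M v = sqrt ((\<Sum>T\<in>cells M. (L2_norm (lebesgue_on T) (v0 v T))\<^sup>2)
     + (\<Sum>e\<in>faces M. (L2_norm (fmeas M e) (vb v e))\<^sup>2 + (L2_norm (fmeas M e) (vn v e))\<^sup>2))"

text \<open>\<open>w\<close> is the weak time derivative of \<open>u\<close> on \<open>(0,\<tau>)\<close>, tested with \<open>C\<^sup>1\<close> functions of compact support
  in \<open>(0,\<tau>)\<close>. The integrals, with values in the finite dimensional function space \<open>V\<^sub>h\<^sup>0\<close>, are computed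
  pointwise.\<close>

definition weak_time_deriv :: "real \<Rightarrow> (real \<Rightarrow> 'a wg) \<Rightarrow> (real \<Rightarrow> 'a wg) \<Rightarrow> bool" where
  "weak_time_deriv \<tau> u w \<longleftrightarrow>
     (\<forall>\<phi> \<phi>' :: real \<Rightarrow> real.
        (\<forall>t. (\<phi> has_real_derivative \<phi>' t) (at t)) \<and> continuous_on UNIV \<phi>' \<and>
        (\<exists>a b. 0 < a \<and> b < \<tau> \<and> (\<forall>t. t \<notin> {a..b} \<longrightarrow> \<phi> t = 0)) \<longrightarrow>
        (\<forall>D x.
           (LINT t|lebesgue_on {0<..<\<tau>}. v0 (u t) D x * \<phi>' t) =
             - (LINT t|lebesgue_on {0<..<\<tau>}. v0 (w t) D x * \<phi> t) \<and>
           (LINT t|lebesgue_on {0<..<\<tau>}. vb (u t) D x * \<phi>' t) =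
             - (LINT t|lebesgue_on {0<..<\<tau>}. vb (w t) D x * \<phi> t) \<and>
           (LINT t|lebesgue_on {0<..<\<tau>}. vn (u t) D x * \<phi>' t) =
             - (LINT t|lebesgue_on {0<..<\<tau>}. vn (w t) D x * \<phi> t)))"

text \<open>\<open>u \<in> H\<^sup>1(0,\<tau>;V\<^sub>h\<^sup>0)\<close> with weak derivative \<open>w\<close>. As usual, \<open>u\<close> denotes the representative that is
  continuous on \<open>[0,\<tau>]\<close>, which gives \<open>u 0\<close> its meaning.\<close>

definition H1_time ::
    "real \<Rightarrow> (real^'n::finite) set \<Rightarrow> (real^'n) mesh \<Rightarrow> nat \<Rightarrow>
     (real \<Rightarrow> (real^'n) wg) \<Rightarrow> (real \<Rightarrow> (real^'n) wg) \<Rightarrow> bool" where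
  "H1_time \<tau> \<Omega> M k u w \<longleftrightarrow>
     bochner_L2 \<tau> (Vh0 \<Omega> M k) (wg_norm M) u \<and> bochner_L2 \<tau> (Vh0 \<Omega> M k) (wg_norm M) w \<and>
     weak_time_deriv \<tau> u w \<and>
     (\<forall>t\<in>{0..\<tau>}. u t \<in> Vh0 \<Omega> M k \<and>
        ((\<lambda>s. wg_norm M (u s - u t)) \<longlongrightarrow> 0) (at t within {0..\<tau>}))"

definition semidiscrete_solution ::
    "real \<Rightarrow> (real^'n::finite) set \<Rightarrow> (real^'n) mesh \<Rightarrow> nat \<Rightarrow> nat \<Rightarrow> (real \<Rightarrow> real^'n \<Rightarrow> real) \<Rightarrow>
     (real^'n \<Rightarrow> real) \<Rightarrow> (real \<Rightarrow> (real^'n) wg) \<Rightarrow> bool" where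
  "semidiscrete_solution \<tau> \<Omega> M k r f \<psi> u \<longleftrightarrow>
     (\<exists>w. H1_time \<tau> \<Omega> M k u w \<and> u 0 = Qh \<Omega> M k \<psi> \<and>
        (AE t in lebesgue_on {0<..\<tau>}. \<forall>v\<in>Vh0 \<Omega> M k.
           (\<Sum>T\<in>cells M. L2_ip (lebesgue_on T) (v0 (w t) T) (v0 v T)) + wg_form M r (u t) v
           = (\<Sum>T\<in>cells M. L2_ip (lebesgue_on T) (f t) (v0 v T))))"

end

theory Submission
  imports Defs
begin

text \<open>
  Let \<open>u = u\<^sub>1 - u\<^sub>2\<close> be the difference of two solutions and write \<open>a\<close> for the bilinear form \<open>wg_form\<close>.
  Then \<open>u(0) = 0\<close> and \<open>(u\<^sub>0', v\<^sub>0) + a(u, v) = 0\<close> for all \<open>v\<close> and almost every time. Testing with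
  \<open>v = u(t)\<close> gives the energy identity \<open>d/dt \<parallel>u\<^sub>0\<parallel>\<^sup>2 = - 2 a(u, u) \<le> 0\<close>. Hence \<open>u\<^sub>0 = 0\<close> at all times, then
  \<open>a(u, u) = |||u|||\<^sup>2 = 0\<close>, and by the norm equivalence \<open>\<parallel>u\<parallel>\<^sub>2\<^sub>,\<^sub>h = 0\<close>. This determines the boundary components:
  with \<open>u\<^sub>0 = 0\<close>, the face terms of that norm are the norms of \<open>u\<^sub>b\<close> and \<open>u\<^sub>n\<close>.

  The time derivative exists only weakly, so the energy identity is proved in coordinates. On each
  cell \<open>T\<close> fix an \<open>L\<^sup>2\<close> orthonormal basis of the polynomials. For a basis function \<open>b\<close> on \<open>T\<close>, the
  equation says that the coordinate of \<open>u\<^sub>0\<close> along \<open>b\<close> has the weak derivative \<open>- a(u, b)\<close>, where \<open>b\<close>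
  also stands for the discrete function with this single nonzero component. Since \<open>u\<close> is continuous in time and
  \<open>a(., b)\<close> is a bounded functional, this is a continuous function, and by the lemma of du
  Bois-Reymond the coordinate is continuously differentiable (\<open>coordinate_has_derivative\<close>). Thus
  \<open>\<parallel>u\<^sub>0\<parallel>\<^sup>2\<close>, the sum of the squared coordinates, can be differentiated classically. Multiplying the
  coordinates by \<open>a(u, b)\<close> and adding up yields \<open>a(u, (u\<^sub>0, 0, 0))\<close>; it equals \<open>a(u, u)\<close> because the
  equation tested with \<open>(0, u\<^sub>b, u\<^sub>n)\<close> contains no time derivative and says \<open>a(u, (0, u\<^sub>b, u\<^sub>n)) = 0\<close>
  (\<open>wg_form_split\<close>, \<open>wg_form_face_component_zero\<close>, \<open>energy_argument\<close>).

  Two things have to be established about the discrete space. The weak Laplacian is defined by a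
  definite description; the finite-dimensional Riesz theorem shows that it satisfies its defining
  identity, from which linearity and boundedness of \<open>a\<close> follow (\<open>weak_laplacian_char\<close>,
  \<open>Vh_functional_wg_form\<close>). And a polynomial whose \<open>L\<^sup>2\<close> norm on a cell or a face vanishes is zero there
  (\<open>poly_space_definite_cell\<close>, \<open>P_face_definite\<close>), which rests on the fact that the surface measure of a face
  charges every relatively open part of it (\<open>face_measure_charges\<close>).
\<close>

section \<open>Square-integrable functions\<close>

lemma L2_mult_integrable:
  assumes "f \<in> L2 m" "g \<in> L2 m"
  shows "integrable m (\<lambda>x. f x * g x)"
proof (rule Bochner_Integration.integrable_bound)
  show "integrable m (\<lambda>x. (f x)\<^sup>2 + (g x)\<^sup>2)"
    using assms by (auto simp: L2_def)
  show "(\<lambda>x. f x * g x) \<in> borel_measurable m"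
    using assms by (auto simp: L2_def)
  have "\<bar>a * b\<bar> \<le> a\<^sup>2 + b\<^sup>2" for a b :: real
  proof -
    have "0 \<le> (\<bar>a\<bar> - \<bar>b\<bar>)\<^sup>2" by simp
    then have "2 * (\<bar>a\<bar> * \<bar>b\<bar>) \<le> a\<^sup>2 + b\<^sup>2" by (simp add: power2_diff)
    moreover have "0 \<le> \<bar>a\<bar> * \<bar>b\<bar>" by simp
    ultimately show ?thesis unfolding abs_mult by linarith
  qed
  then show "AE x in m. norm (f x * g x) \<le> norm ((f x)\<^sup>2 + (g x)\<^sup>2)"
    by simp
qed

lemma L2_lincomb:
  assumes "f \<in> L2 m" "g \<in> L2 m"
  shows "(\<lambda>x. c * f x + g x) \<in> L2 m"
proof -
  have "(\<lambda>x. (c * f x + g x)\<^sup>2) = (\<lambda>x. c\<^sup>2 * (f x)\<^sup>2 + 2 * c * (f x * g x) + (g x)\<^sup>2)"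
    by (auto simp: power2_sum algebra_simps power2_eq_square)
  then show ?thesis
    using assms L2_mult_integrable[OF assms] by (auto simp: L2_def)
qed

lemma L2_zero: "(\<lambda>x. 0) \<in> L2 m"
  by (simp add: L2_def)

lemma L2_ip_commute: "L2_ip m f g = L2_ip m g f"
  by (simp add: L2_ip_def mult.commute)

lemma L2_ip_zero [simp]: "L2_ip m (\<lambda>x. 0) g = 0" "L2_ip m g (\<lambda>x. 0) = 0"
  by (simp_all add: L2_ip_def)

lemma L2_ip_lincomb:
  assumes "f \<in> L2 m" "g \<in> L2 m" "h \<in> L2 m"
  shows "L2_ip m (\<lambda>x. c * f x + g x) h = c * L2_ip m f h + L2_ip m g h"
    and "L2_ip m h (\<lambda>x. c * f x + g x) = c * L2_ip m h f + L2_ip m h g"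
proof -
  show *: "L2_ip m (\<lambda>x. c * f x + g x) h = c * L2_ip m f h + L2_ip m g h"
    unfolding L2_ip_def
    using L2_mult_integrable[OF assms(1,3)] L2_mult_integrable[OF assms(2,3)]
    by (simp add: distrib_right mult.assoc)
  then show "L2_ip m h (\<lambda>x. c * f x + g x) = c * L2_ip m h f + L2_ip m h g"
    by (simp add: L2_ip_commute[of m h])
qed

lemma L2_ip_diff:
  assumes "f \<in> L2 m" "g \<in> L2 m" "h \<in> L2 m"
  shows "L2_ip m (\<lambda>x. f x - g x) h = L2_ip m f h - L2_ip m g h"
  using L2_ip_lincomb(1)[OF assms(2,1,3), of "-1"] by simp

lemma L2_sum:
  assumes "\<And>b. b \<in> B \<Longrightarrow> b \<in> L2 m"
  shows "(\<lambda>x. \<Sum>b\<in>B. c b * b x) \<in> L2 m"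
  using assms
proof (induction B rule: infinite_finite_induct)
  case (insert b B)
  then show ?case using L2_lincomb[of b m "\<lambda>x. \<Sum>b\<in>B. c b * b x" "c b"] by simp
qed (auto intro: L2_zero)

lemma L2_ip_sum:
  assumes "\<And>b. b \<in> B \<Longrightarrow> b \<in> L2 m" "g \<in> L2 m"
  shows "L2_ip m (\<lambda>x. \<Sum>b\<in>B. c b * b x) g = (\<Sum>b\<in>B. c b * L2_ip m b g)"
  using assms
proof (induction B rule: infinite_finite_induct)
  case (insert b B)
  then show ?case
    using L2_ip_lincomb(1)[of b m "\<lambda>x. \<Sum>b\<in>B. c b * b x" g "c b"] L2_sum[of B m c] by simp
qed auto

lemma L2_norm_nonneg [simp]: "0 \<le> L2_norm m f"
  by (simp add: L2_norm_def)

lemma L2_norm_square: "(L2_norm m f)\<^sup>2 = L2_ip m f f"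
  by (simp add: L2_norm_def L2_ip_def power2_eq_square)

lemma L2_ip_self_nonneg [simp]: "0 \<le> L2_ip m f f"
  by (simp flip: L2_norm_square)

lemma L2_norm_eq_0_AE:
  assumes "f \<in> L2 m" "L2_norm m f = 0"
  shows "AE x in m. f x = 0"
proof -
  have "(LINT x|m. (f x)\<^sup>2) = 0" using assms by (simp add: L2_norm_def)
  then have "AE x in m. (f x)\<^sup>2 = 0"
    using assms by (subst (asm) integral_nonneg_eq_0_iff_AE) (auto simp: L2_def)
  then show ?thesis by simp
qed

text \<open>The minimum over \<open>c\<close> of \<open>\<parallel>f + c g\<parallel>\<^sup>2\<close>, which is nonnegative, is attained at
  \<open>c = - (f, g) / \<parallel>g\<parallel>\<^sup>2\<close>. If \<open>\<parallel>g\<parallel> = 0\<close>, then \<open>g\<close> vanishes almost everywhere and so does the integrand of \<open>(f, g)\<close>.\<close>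

lemma L2_Cauchy_Schwarz:
  assumes "f \<in> L2 m" "g \<in> L2 m"
  shows "\<bar>L2_ip m f g\<bar> \<le> L2_norm m f * L2_norm m g"
proof (cases "L2_norm m g = 0")
  case True
  then have "AE x in m. g x = 0" using assms L2_norm_eq_0_AE by blast
  then have "L2_ip m f g = 0"
    unfolding L2_ip_def by (intro integral_eq_zero_AE) auto
  then show ?thesis by simp
next
  case False
  then have D: "L2_ip m g g > 0"
    by (metis L2_ip_self_nonneg L2_norm_square order_le_less zero_eq_power2)
  define c where "c = - (L2_ip m f g / L2_ip m g g)"
  have h: "(\<lambda>x. c * g x + f x) \<in> L2 m" using assms by (intro L2_lincomb)
  have "0 \<le> L2_ip m (\<lambda>x. c * g x + f x) (\<lambda>x. c * g x + f x)" by simp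
  also have "\<dots> = c * (c * L2_ip m g g + L2_ip m f g) + (c * L2_ip m f g + L2_ip m f f)"
    using assms h by (simp add: L2_ip_lincomb L2_ip_commute[of m g f])
  also have "\<dots> = L2_ip m f f - (L2_ip m f g)\<^sup>2 / L2_ip m g g"
    using D by (simp add: c_def field_simps power2_eq_square)
  finally have "(L2_ip m f g)\<^sup>2 \<le> L2_ip m f f * L2_ip m g g"
    using D by (simp add: field_simps)
  also have "\<dots> = (L2_norm m f * L2_norm m g)\<^sup>2"
    by (simp add: power_mult_distrib L2_norm_square)
  finally show ?thesis
    by (metis L2_norm_nonneg abs_le_square_iff abs_of_nonneg mult_nonneg_nonneg)
qed

section \<open>Orthonormal bases of finite-dimensional function spaces\<close>

definition function_subspace :: "('a \<Rightarrow> real) set \<Rightarrow> bool" where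
  "function_subspace X \<longleftrightarrow> (\<lambda>x. 0) \<in> X \<and> (\<forall>f\<in>X. \<forall>g\<in>X. \<forall>c. (\<lambda>x. c * f x + g x) \<in> X)"

lemma function_subspace_lincomb:
  assumes "function_subspace X" "f \<in> X" "g \<in> X"
  shows "(\<lambda>x. c * f x + g x) \<in> X"
  using assms unfolding function_subspace_def by blast

lemma function_subspace_diff:
  assumes "function_subspace X" "f \<in> X" "g \<in> X"
  shows "(\<lambda>x. f x - g x) \<in> X"
proof -
  show ?thesis using function_subspace_lincomb[OF assms(1,3,2), of "-1"] by simp
qed

lemma function_subspace_sum:
  assumes "function_subspace X" "\<And>b. b \<in> B \<Longrightarrow> F b \<in> X"
  shows "(\<lambda>x. \<Sum>b\<in>B. c b * F b x) \<in> X"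
  using assms(2)
proof (induction B rule: infinite_finite_induct)
  case (insert b B)
  then have "F b \<in> X" "(\<lambda>x. \<Sum>b\<in>B. c b * F b x) \<in> X" by auto
  then have "(\<lambda>x. c b * F b x + (\<Sum>b\<in>B. c b * F b x)) \<in> X"
    by (rule function_subspace_lincomb[OF assms(1)])
  then show ?case using insert by simp
qed (use assms in \<open>auto simp: function_subspace_def\<close>)

lemma functional_sum:
  fixes L :: "('a \<Rightarrow> real) \<Rightarrow> real"
  assumes "function_subspace X" "\<And>b. b \<in> B \<Longrightarrow> b \<in> X"
    and lin: "\<And>f g c. f \<in> X \<Longrightarrow> g \<in> X \<Longrightarrow> L (\<lambda>x. c * f x + g x) = c * L f + L g"
  shows "L (\<lambda>x. \<Sum>b\<in>B. c b * b x) = (\<Sum>b\<in>B. c b * L b)"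
proof -
  have z: "(\<lambda>x. 0) \<in> X" using assms(1) by (simp add: function_subspace_def)
  have "L (\<lambda>x. 0) = 0" using lin[OF z z, of 1] by simp
  then show ?thesis using assms(2)
  proof (induction B rule: infinite_finite_induct)
    case (insert b B)
    have "(\<lambda>x. \<Sum>b\<in>B. c b * b x) \<in> X"
      using insert.prems by (intro function_subspace_sum[OF assms(1)]) auto
    then have "L (\<lambda>x. c b * b x + (\<Sum>b\<in>B. c b * b x)) = c b * L b + L (\<lambda>x. \<Sum>b\<in>B. c b * b x)"
      using insert.prems by (intro lin) auto
    then show ?case using insert by simp
  qed auto
qed

text \<open>An orthonormal basis replaces all the linear algebra of finite-dimensional spaces: the last
  conjunct is an identity of functions, at every point, so it turns statements about the values of
  \<open>f\<close> into statements about its coordinates and back.\<close>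

definition orthonormal_basis :: "'a measure \<Rightarrow> ('a \<Rightarrow> real) set \<Rightarrow> ('a \<Rightarrow> real) set \<Rightarrow> bool" where
  "orthonormal_basis m X B \<longleftrightarrow> finite B \<and> B \<subseteq> X \<and>
     (\<forall>p\<in>B. \<forall>q\<in>B. L2_ip m p q = (if p = q then 1 else 0)) \<and>
     (\<forall>f\<in>X. f = (\<lambda>x. \<Sum>b\<in>B. L2_ip m f b * b x))"

lemma orthonormal_basisD:
  assumes "orthonormal_basis m X B"
  shows "finite B" "B \<subseteq> X"
    "\<And>p q. p \<in> B \<Longrightarrow> q \<in> B \<Longrightarrow> L2_ip m p q = (if p = q then 1 else 0)"
    "\<And>f. f \<in> X \<Longrightarrow> f = (\<lambda>x. \<Sum>b\<in>B. L2_ip m f b * b x)"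
  using assms unfolding orthonormal_basis_def by blast+

text \<open>Gram-Schmidt: a new function \<open>g\<close> is orthogonalised against the family found so far. Either the
  remainder \<open>g'\<close> has norm zero, and then by definiteness it is zero and \<open>g\<close> is already
  represented, or it is normalised and added.\<close>

lemma orthonormal_family_exists:
  assumes X: "function_subspace X" "X \<subseteq> L2 m"
    and definite: "\<And>f. f \<in> X \<Longrightarrow> L2_norm m f = 0 \<Longrightarrow> f = (\<lambda>x. 0)"
    and G: "finite G" "G \<subseteq> X"
  shows "\<exists>B. finite B \<and> B \<subseteq> X \<and> (\<forall>p\<in>B. \<forall>q\<in>B. L2_ip m p q = (if p = q then 1 else 0)) \<and>
     (\<forall>g\<in>G. g = (\<lambda>x. \<Sum>b\<in>B. L2_ip m g b * b x))"
  using G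
proof (induction G rule: finite_induct)
  case empty
  show ?case by (intro exI[of _ "{}"]) auto
next
  case (insert g G)
  have GX: "G \<subseteq> X" using insert.prems by blast
  obtain B where B: "finite B" "B \<subseteq> X"
      "\<And>p q. p \<in> B \<Longrightarrow> q \<in> B \<Longrightarrow> L2_ip m p q = (if p = q then 1 else 0)"
      "\<And>g. g \<in> G \<Longrightarrow> g = (\<lambda>x. \<Sum>b\<in>B. L2_ip m g b * b x)"
    using insert.IH[OF GX] by blast
  have gX: "g \<in> X" using insert.prems by auto
  define s where "s = (\<lambda>x. \<Sum>b\<in>B. L2_ip m g b * b x)"
  define g' where "g' = (\<lambda>x. g x - s x)"
  have sX: "s \<in> X" unfolding s_def using B(2) by (intro function_subspace_sum[OF X(1)]) auto
  have g'X: "g' \<in> X" unfolding g'_def by (intro function_subspace_diff X gX sX)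
  have BL2: "b \<in> L2 m" if "b \<in> B" for b using that B(2) X(2) by blast
  have g'orth: "L2_ip m g' b = 0" if b: "b \<in> B" for b
  proof -
    have "L2_ip m s b = (\<Sum>c\<in>B. L2_ip m g c * L2_ip m c b)"
      unfolding s_def by (rule L2_ip_sum[OF BL2 BL2[OF b]])
    also have "\<dots> = (\<Sum>c\<in>B. if c = b then L2_ip m g b else 0)"
      by (rule sum.cong[OF refl]) (simp add: B(3) b)
    also have "\<dots> = L2_ip m g b" using b B(1) by simp
    finally have "L2_ip m s b = L2_ip m g b" .
    moreover have "L2_ip m g' b = L2_ip m g b - L2_ip m s b"
      unfolding g'_def using gX sX X(2) BL2[OF b] by (intro L2_ip_diff) auto
    ultimately show ?thesis by simp
  qed
  show ?case
  proof (cases "L2_norm m g' = 0")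
    case True
    then have "g' = (\<lambda>x. 0)" using definite g'X by blast
    then have "g x = s x" for x unfolding g'_def by (metis eq_iff_diff_eq_0)
    then have "g = (\<lambda>x. \<Sum>b\<in>B. L2_ip m g b * b x)" unfolding s_def by blast
    then have expand: "\<forall>f\<in>insert g G. f = (\<lambda>x. \<Sum>b\<in>B. L2_ip m f b * b x)" using B(4) by blast
    have "\<forall>p\<in>B. \<forall>q\<in>B. L2_ip m p q = (if p = q then 1 else 0)" using B(3) by blast
    then show ?thesis by (intro exI[of _ B] conjI B(1,2) expand)
  next
    case False
    define a where "a = L2_norm m g'"
    have a: "a > 0" using False unfolding a_def by (simp add: order_less_le)
    define e where "e = (\<lambda>x. inverse a * g' x + 0)"
    have eX: "e \<in> X" unfolding e_def using X(1) g'X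
      by (intro function_subspace_lincomb) (auto simp: function_subspace_def)
    have e_ip: "L2_ip m e f = inverse a * L2_ip m g' f" if "f \<in> X" for f
      unfolding e_def using L2_ip_lincomb(1)[of g' m "\<lambda>x. 0" f] that g'X X(2) L2_zero by auto
    have eb: "L2_ip m e b = 0" if "b \<in> B" for b
      using e_ip[of b] g'orth[OF that] that B(2) by auto
    have ee: "L2_ip m e e = 1"
    proof -
      have "L2_ip m g' e = inverse a * L2_ip m g' g'"
        using e_ip[OF g'X] by (simp add: L2_ip_commute)
      also have "L2_ip m g' g' = a * a" 
        by (simp add: a_def flip: L2_norm_square power2_eq_square)
      finally show ?thesis using e_ip[OF eX] a by (simp add: field_simps)
    qed
    have e_notin: "e \<notin> B" using eb ee by force
    have ge: "L2_ip m g e = a"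
    proof -
      have "L2_ip m s e = (\<Sum>b\<in>B. L2_ip m g b * L2_ip m b e)"
        unfolding s_def using eX X BL2 by (intro L2_ip_sum) auto
      also have "\<dots> = 0" using eb L2_ip_commute[of m e] by (intro sum.neutral) auto
      finally have "L2_ip m g' e = L2_ip m g e" unfolding g'_def
        using L2_ip_diff[of g m s e] gX sX eX X(2) by auto
      moreover have "L2_ip m g' e = inverse a * (a * a)"
        using e_ip[OF g'X] by (simp add: L2_ip_commute a_def flip: L2_norm_square power2_eq_square)
      ultimately have "L2_ip m g e = inverse a * (a * a)" by simp
      then show ?thesis using a by simp
    qed
    have "g x = (\<Sum>b\<in>insert e B. L2_ip m g b * b x)" for x
    proof -
      have "(\<Sum>b\<in>insert e B. L2_ip m g b * b x) = a * e x + s x"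
        using e_notin B(1) ge by (simp add: s_def)
      also have "\<dots> = g' x + s x" using a by (simp add: e_def)
      finally show ?thesis by (simp add: g'_def)
    qed
    moreover have "f = (\<lambda>x. \<Sum>b\<in>insert e B. L2_ip m f b * b x)" if f: "f \<in> G" for f
    proof -
      have f0: "f = (\<lambda>x. \<Sum>b\<in>B. L2_ip m f b * b x)" using B(4)[OF f] .
      have "L2_ip m f e = L2_ip m (\<lambda>x. \<Sum>b\<in>B. L2_ip m f b * b x) e"
        by (rule arg_cong[of _ _ "\<lambda>f. L2_ip m f e", OF f0])
      also have "\<dots> = (\<Sum>b\<in>B. L2_ip m f b * L2_ip m b e)"
        using eX X(2) BL2 by (intro L2_ip_sum) auto
      also have "\<dots> = 0" using eb L2_ip_commute[of m e] by (intro sum.neutral) auto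
      finally have "(\<Sum>b\<in>insert e B. L2_ip m f b * b x) = (\<Sum>b\<in>B. L2_ip m f b * b x)" for x
        using e_notin B(1) by simp
      then show ?thesis using f0 by presburger
    qed
    ultimately have expand: "\<forall>f\<in>insert g G. f = (\<lambda>x. \<Sum>b\<in>insert e B. L2_ip m f b * b x)"
      by blast
    have "insert e B \<subseteq> X" "finite (insert e B)" using B(1,2) eX by auto
    moreover have "\<forall>p\<in>insert e B. \<forall>q\<in>insert e B. L2_ip m p q = (if p = q then 1 else 0)"
    proof (intro ballI)
      fix p q assume "p \<in> insert e B" "q \<in> insert e B"
      then consider "p = e" "q = e" | "p = e" "q \<in> B" | "p \<in> B" "q = e" | "p \<in> B" "q \<in> B"
        by blast
      then show "L2_ip m p q = (if p = q then 1 else 0)"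
      proof cases
        case 3
        then show ?thesis using eb[of p] e_notin L2_ip_commute[of m p e] by auto
      qed (use B(3) ee eb e_notin in auto)
    qed
    ultimately show ?thesis by (intro exI[of _ "insert e B"] conjI expand)
  qed
qed

lemma orthonormal_basis_exists:
  assumes X: "function_subspace X" "X \<subseteq> L2 m"
    and definite: "\<And>f. f \<in> X \<Longrightarrow> L2_norm m f = 0 \<Longrightarrow> f = (\<lambda>x. 0)"
    and G: "finite G" "G \<subseteq> X"
    and span: "\<And>f. f \<in> X \<Longrightarrow> \<exists>c. f = (\<lambda>x. \<Sum>g\<in>G. c g * g x)"
  shows "\<exists>B. orthonormal_basis m X B"
proof -
  obtain B where B: "finite B" "B \<subseteq> X"
      "\<forall>p\<in>B. \<forall>q\<in>B. L2_ip m p q = (if p = q then 1 else 0)"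
      "\<And>g. g \<in> G \<Longrightarrow> g = (\<lambda>x. \<Sum>b\<in>B. L2_ip m g b * b x)"
    using orthonormal_family_exists[OF X definite G] by blast
  have "f = (\<lambda>x. \<Sum>b\<in>B. L2_ip m f b * b x)" if "f \<in> X" for f
  proof -
    obtain c where c: "f = (\<lambda>x. \<Sum>g\<in>G. c g * g x)" using span \<open>f \<in> X\<close> by blast
    have "f x = (\<Sum>b\<in>B. L2_ip m f b * b x)" for x
    proof -
      have "f x = (\<Sum>g\<in>G. c g * (\<Sum>b\<in>B. L2_ip m g b * b x))"
        using B(4) by (subst c, intro sum.cong refl) (metis (no_types, lifting))
      also have "\<dots> = (\<Sum>g\<in>G. \<Sum>b\<in>B. c g * L2_ip m g b * b x)"
        by (simp add: sum_distrib_left mult.assoc)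
      also have "\<dots> = (\<Sum>b\<in>B. \<Sum>g\<in>G. c g * L2_ip m g b * b x)" by (rule sum.swap)
      also have "\<dots> = (\<Sum>b\<in>B. L2_ip m f b * b x)"
      proof (rule sum.cong[OF refl])
        fix b assume b: "b \<in> B"
        have "L2_ip m f b = (\<Sum>g\<in>G. c g * L2_ip m g b)"
          unfolding c using b B(2) G X by (intro L2_ip_sum) auto
        then show "(\<Sum>g\<in>G. c g * L2_ip m g b * b x) = L2_ip m f b * b x"
          by (simp add: sum_distrib_right)
      qed
      finally show ?thesis .
    qed
    then show ?thesis by blast
  qed
  then show ?thesis using B unfolding orthonormal_basis_def by blast
qed

text \<open>The finite-dimensional Riesz theorem; the representer of \<open>L\<close> has the coordinates \<open>L b\<close>. It makes
  the definite description in the definition of the weak Laplacian meaningful.\<close>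

lemma orthonormal_basis_Riesz:
  assumes B: "orthonormal_basis m X B" and X: "function_subspace X" "X \<subseteq> L2 m"
    and lin: "\<And>f g c. f \<in> X \<Longrightarrow> g \<in> X \<Longrightarrow> L (\<lambda>x. c * f x + g x) = c * L f + L g"
  shows "\<exists>!w. w \<in> X \<and> (\<forall>\<phi>\<in>X. L2_ip m w \<phi> = L \<phi>)"
proof (rule ex_ex1I)
  define w where "w = (\<lambda>x. \<Sum>b\<in>B. L b * b x)"
  note BX = orthonormal_basisD(2)[OF B]
  have wX: "w \<in> X" unfolding w_def using BX by (intro function_subspace_sum[OF X(1)]) auto
  have "L2_ip m w \<phi> = L \<phi>" if "\<phi> \<in> X" for \<phi>
  proof -
    have \<phi>: "\<phi> = (\<lambda>x. \<Sum>b\<in>B. L2_ip m \<phi> b * b x)"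
      by (rule orthonormal_basisD(4)[OF B that])
    have "L2_ip m w \<phi> = (\<Sum>b\<in>B. L b * L2_ip m b \<phi>)"
      unfolding w_def using BX X(2) that by (intro L2_ip_sum) auto
    also have "\<dots> = (\<Sum>b\<in>B. L2_ip m \<phi> b * L b)"
      by (intro sum.cong) (auto simp: L2_ip_commute)
    also have "\<dots> = L (\<lambda>x. \<Sum>b\<in>B. L2_ip m \<phi> b * b x)"
      by (rule functional_sum[OF X(1), symmetric, of B L]) (use BX lin in auto)
    also have "\<dots> = L \<phi>" by (rule arg_cong[of _ _ L, OF \<phi>[symmetric]])
    finally show ?thesis .
  qed
  with wX show "\<exists>w. w \<in> X \<and> (\<forall>\<phi>\<in>X. L2_ip m w \<phi> = L \<phi>)" by blast
next
  fix u v
  define w where "w = (\<lambda>x. \<Sum>b\<in>B. L b * b x)"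
  have *: "z = w" if "z \<in> X \<and> (\<forall>\<phi>\<in>X. L2_ip m z \<phi> = L \<phi>)" for z
  proof -
    have "z = (\<lambda>x. \<Sum>b\<in>B. L2_ip m z b * b x)"
      using orthonormal_basisD(4)[OF B] that by blast
    also have "\<dots> = w" unfolding w_def
      using that orthonormal_basisD(2)[OF B] by (intro ext sum.cong) auto
    finally show ?thesis .
  qed
  show "u = v" if "u \<in> X \<and> (\<forall>\<phi>\<in>X. L2_ip m u \<phi> = L \<phi>)" "v \<in> X \<and> (\<forall>\<phi>\<in>X. L2_ip m v \<phi> = L \<phi>)"
    using * that by metis
qed

section \<open>Polynomials of bounded degree\<close>

definition monomial :: "('n::finite \<Rightarrow> nat) \<Rightarrow> real^'n \<Rightarrow> real" where
  "monomial \<alpha> x = (\<Prod>i\<in>UNIV. (x $ i) ^ \<alpha> i)"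

definition multi_indices :: "nat \<Rightarrow> ('n::finite \<Rightarrow> nat) set" where
  "multi_indices k = {\<alpha>. (\<Sum>i\<in>UNIV. \<alpha> i) \<le> k}"

lemma finite_multi_indices: "finite (multi_indices k)"
proof (rule finite_subset)
  show "multi_indices k \<subseteq> (UNIV::'a set) \<rightarrow>\<^sub>E {..k}"
  proof
    fix \<alpha> :: "'a \<Rightarrow> nat" assume "\<alpha> \<in> multi_indices k"
    then have "\<alpha> i \<le> k" for i
      using member_le_sum[of i UNIV \<alpha>] by (simp add: multi_indices_def)
    then show "\<alpha> \<in> UNIV \<rightarrow>\<^sub>E {..k}" by auto
  qed
qed (auto intro: finite_PiE)

lemma poly_space_eq:
  "poly_space k = {p. \<exists>c. p = (\<lambda>x. \<Sum>\<alpha>\<in>multi_indices k. c \<alpha> * monomial \<alpha> x)}"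
  by (simp add: poly_space_def monomial_def multi_indices_def)

lemma poly_spaceI: "(\<lambda>x. \<Sum>\<alpha>\<in>multi_indices k. c \<alpha> * monomial \<alpha> x) \<in> poly_space k"
  unfolding poly_space_eq by blast

lemma function_subspace_poly_space: "function_subspace (poly_space k)"
  unfolding function_subspace_def
proof (intro conjI ballI allI)
  show "(\<lambda>x. 0) \<in> poly_space k"
    unfolding poly_space_eq by (auto intro!: exI[of _ "\<lambda>_. 0"])
  fix f g :: "real^'n \<Rightarrow> real" and c :: real
  assume "f \<in> poly_space k" "g \<in> poly_space k"
  then obtain a b where "f = (\<lambda>x. \<Sum>\<alpha>\<in>multi_indices k. a \<alpha> * monomial \<alpha> x)"
      "g = (\<lambda>x. \<Sum>\<alpha>\<in>multi_indices k. b \<alpha> * monomial \<alpha> x)"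
    unfolding poly_space_eq by blast
  then have "(\<lambda>x. c * f x + g x) = (\<lambda>x. \<Sum>\<alpha>\<in>multi_indices k. (c * a \<alpha> + b \<alpha>) * monomial \<alpha> x)"
    by (simp add: sum_distrib_left sum.distrib algebra_simps)
  then show "(\<lambda>x. c * f x + g x) \<in> poly_space k"
    using poly_spaceI[of "\<lambda>\<alpha>. c * a \<alpha> + b \<alpha>" k] by simp
qed

lemma poly_space_zero: "(\<lambda>x. 0) \<in> poly_space k"
  using function_subspace_poly_space unfolding function_subspace_def by blast

lemma monomial_in_poly_space:
  assumes "\<alpha> \<in> multi_indices k"
  shows "monomial \<alpha> \<in> poly_space k"
proof -
  have "monomial \<alpha> x = (\<Sum>\<beta>\<in>multi_indices k. (if \<beta> = \<alpha> then 1 else 0) * monomial \<beta> x)" for x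
  proof -
    have "(\<Sum>\<beta>\<in>multi_indices k. (if \<beta> = \<alpha> then 1 else 0) * monomial \<beta> x)
        = (\<Sum>\<beta>\<in>multi_indices k. if \<beta> = \<alpha> then monomial \<alpha> x else 0)"
      by (intro sum.cong) auto
    also have "\<dots> = monomial \<alpha> x" using assms by (simp add: finite_multi_indices)
    finally show ?thesis by simp
  qed
  then show ?thesis
    using poly_spaceI[of "\<lambda>\<beta>. if \<beta> = \<alpha> then 1 else 0" k] by presburger
qed

lemma monomial_has_derivative:
  "(monomial \<alpha> has_derivative
     (\<lambda>y. \<Sum>i\<in>UNIV. (of_nat (\<alpha> i) * (y $ i) * (x $ i) ^ (\<alpha> i - 1)) * (\<Prod>j\<in>UNIV-{i}. (x $ j) ^ \<alpha> j))) (at x)"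
proof -
  have "((\<lambda>x. (x $ i) ^ \<alpha> i) has_derivative (\<lambda>y. of_nat (\<alpha> i) * (y $ i) * (x $ i) ^ (\<alpha> i - 1))) (at x)"
    for i
    by (rule has_derivative_power[where f = "\<lambda>x. x $ i" and f' = "\<lambda>y. y $ i", THEN has_derivative_eq_rhs])
       (auto intro!: derivative_eq_intros bounded_linear_imp_has_derivative bounded_linear_vec_nth)
  then show ?thesis unfolding monomial_def[abs_def]
    by (intro has_derivative_prod) auto
qed

lemma partial_monomial:
  "partial i (monomial \<alpha>) x = of_nat (\<alpha> i) * monomial (\<alpha>(i := \<alpha> i - 1)) x"
proof -
  have "partial i (monomial \<alpha>) x =
     (\<Sum>l\<in>UNIV. (of_nat (\<alpha> l) * (axis i 1 $ l) * (x $ l) ^ (\<alpha> l - 1)) * (\<Prod>j\<in>UNIV-{l}. (x $ j) ^ \<alpha> j))"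
    unfolding partial_def
    by (subst frechet_derivative_at[OF monomial_has_derivative, symmetric]) (rule refl)
  also have "\<dots> = (\<Sum>l\<in>UNIV. if l = i then of_nat (\<alpha> i) * (x $ i) ^ (\<alpha> i - 1) * (\<Prod>j\<in>UNIV-{i}. (x $ j) ^ \<alpha> j) else 0)"
    by (intro sum.cong) (auto simp: axis_def)
  also have "\<dots> = of_nat (\<alpha> i) * ((x $ i) ^ (\<alpha> i - 1) * (\<Prod>j\<in>UNIV-{i}. (x $ j) ^ \<alpha> j))"
    by simp
  also have "(x $ i) ^ (\<alpha> i - 1) * (\<Prod>j\<in>UNIV-{i}. (x $ j) ^ \<alpha> j) = monomial (\<alpha>(i := \<alpha> i - 1)) x"
    unfolding monomial_def by (subst (2) prod.remove[of _ i]) auto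
  finally show ?thesis .
qed

lemma poly_space_differentiable:
  assumes "p \<in> poly_space k"
  shows "p differentiable (at x)"
proof -
  obtain c where "p = (\<lambda>x. \<Sum>\<alpha>\<in>multi_indices k. c \<alpha> * monomial \<alpha> x)"
    using assms unfolding poly_space_eq by blast
  moreover have "monomial \<alpha> differentiable (at x)" for \<alpha>
    using monomial_has_derivative differentiable_def by blast
  ultimately show ?thesis using finite_multi_indices
    by (auto intro!: differentiable_sum differentiable_mult)
qed

lemma poly_space_continuous:
  assumes "p \<in> poly_space k"
  shows "continuous_on S p"
  using poly_space_differentiable[OF assms] 
  by (meson continuous_at_imp_continuous_on differentiable_imp_continuous_within)

lemma partial_lincomb:
  assumes "p differentiable (at x)" "q differentiable (at x)"
  shows "partial i (\<lambda>x. c * p x + q x) x = c * partial i p x + partial i q x"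
proof -
  have "(p has_derivative frechet_derivative p (at x)) (at x)"
      "(q has_derivative frechet_derivative q (at x)) (at x)"
    using assms by (simp_all flip: frechet_derivative_works)
  then have "((\<lambda>x. c * p x + q x) has_derivative
      (\<lambda>y. c * frechet_derivative p (at x) y + frechet_derivative q (at x) y)) (at x)"
    by (intro has_derivative_add has_derivative_mult_right)
  from frechet_derivative_at[OF this, symmetric] show ?thesis by (simp add: partial_def)
qed

lemma partial_poly_space_lincomb:
  assumes "p \<in> poly_space k" "q \<in> poly_space k"
  shows "partial i (\<lambda>x. c * p x + q x) = (\<lambda>x. c * partial i p x + partial i q x)"
  using partial_lincomb poly_space_differentiable assms by blast

lemma partial_zero [simp]: "partial i (\<lambda>x. 0) = (\<lambda>x. 0)"
  by (simp add: partial_def fun_eq_iff)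

lemma partial_poly_space:
  assumes "p \<in> poly_space k"
  shows "partial i p \<in> poly_space k"
proof -
  obtain c where p: "p = (\<lambda>x. \<Sum>\<alpha>\<in>multi_indices k. c \<alpha> * monomial \<alpha> x)"
    using assms unfolding poly_space_eq by blast
  have "partial i (\<lambda>x. \<Sum>\<alpha>\<in>A. c \<alpha> * monomial \<alpha> x) \<in> poly_space k" if "A \<subseteq> multi_indices k" for A
    using finite_subset[OF that finite_multi_indices] that
  proof (induction A rule: finite_induct)
    case empty
    then show ?case by (simp add: poly_space_zero)
  next
    case (insert \<alpha> A)
    have \<alpha>: "\<alpha> \<in> multi_indices k" using insert by simp
    have S: "(\<lambda>x. \<Sum>\<alpha>\<in>A. c \<alpha> * monomial \<alpha> x) \<in> poly_space k"
      using insert.prems monomial_in_poly_space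
      by (intro function_subspace_sum[OF function_subspace_poly_space]) auto
    have "(\<Sum>j\<in>UNIV. (\<alpha>(i := \<alpha> i - 1)) j) \<le> (\<Sum>j\<in>UNIV. \<alpha> j)"
      by (intro sum_mono) auto
    then have "\<alpha>(i := \<alpha> i - 1) \<in> multi_indices k"
      using \<alpha> by (simp add: multi_indices_def)
    then have mon: "monomial (\<alpha>(i := \<alpha> i - 1)) \<in> poly_space k" by (rule monomial_in_poly_space)
    have "partial i (\<lambda>x. \<Sum>\<alpha>\<in>insert \<alpha> A. c \<alpha> * monomial \<alpha> x)
        = (\<lambda>x. c \<alpha> * partial i (monomial \<alpha>) x + partial i (\<lambda>x. \<Sum>\<alpha>\<in>A. c \<alpha> * monomial \<alpha> x) x)"
      using insert.hyps
      by (simp add: partial_poly_space_lincomb[OF monomial_in_poly_space[OF \<alpha>] S])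
    also have "\<dots> = (\<lambda>x. (c \<alpha> * of_nat (\<alpha> i)) * monomial (\<alpha>(i := \<alpha> i - 1)) x
                       + partial i (\<lambda>x. \<Sum>\<alpha>\<in>A. c \<alpha> * monomial \<alpha> x) x)"
      by (simp add: partial_monomial mult.assoc)
    also have "\<dots> \<in> poly_space k"
      using insert.IH insert.prems
      by (intro function_subspace_lincomb[OF function_subspace_poly_space mon]) blast
    finally show ?case .
  qed
  then show ?thesis using p by blast
qed

lemma laplacian_poly_space:
  assumes "p \<in> poly_space k"
  shows "laplacian p \<in> poly_space k"
  using function_subspace_sum[OF function_subspace_poly_space, of UNIV "\<lambda>i. partial i (partial i p)" k "\<lambda>_. 1"]
  by (simp add: laplacian_def[abs_def] partial_poly_space assms)

lemma laplacian_lincomb: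
  assumes "p \<in> poly_space k" "q \<in> poly_space k"
  shows "laplacian (\<lambda>x. c * p x + q x) = (\<lambda>x. c * laplacian p x + laplacian q x)"
  by (simp add: laplacian_def[abs_def] partial_poly_space_lincomb[OF assms] partial_poly_space assms
      partial_poly_space_lincomb[OF partial_poly_space partial_poly_space, OF assms]
      sum.distrib sum_distrib_left)

lemma grad_inner_poly_space:
  assumes "p \<in> poly_space k"
  shows "(\<lambda>x. grad p x \<bullet> n) \<in> poly_space k"
proof -
  have "(\<lambda>x. grad p x \<bullet> n) = (\<lambda>x. \<Sum>i\<in>UNIV. (n $ i) * partial i p x)"
    by (simp add: grad_def inner_vec_def mult.commute)
  then show ?thesis
    using function_subspace_sum[OF function_subspace_poly_space, of UNIV "\<lambda>i. partial i p" k "\<lambda>i. n $ i"]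
    by (simp add: partial_poly_space assms)
qed

lemma grad_inner_lincomb:
  assumes "p \<in> poly_space k" "q \<in> poly_space k"
  shows "(\<lambda>x. grad (\<lambda>x. c * p x + q x) x \<bullet> n) = (\<lambda>x. c * (grad p x \<bullet> n) + grad q x \<bullet> n)"
  by (simp add: grad_def inner_vec_def partial_poly_space_lincomb[OF assms] sum.distrib
      sum_distrib_left distrib_right mult.assoc)

text \<open>Restricted to a line, a polynomial is a polynomial in one variable; one that vanishes on a
  ball has infinitely many zeros on every line through the centre of the ball.\<close>

lemma poly_space_vanishing_on_ball:
  assumes p: "p \<in> poly_space k" and "\<epsilon> > 0" and zero: "\<And>x. x \<in> ball a \<epsilon> \<Longrightarrow> p x = 0"
  shows "p = (\<lambda>x. 0)"
proof
  fix x
  define d where "d = x - a"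
  obtain c where c: "p = (\<lambda>x. \<Sum>\<alpha>\<in>multi_indices k. c \<alpha> * monomial \<alpha> x)"
    using p unfolding poly_space_eq by blast
  define q :: "real poly" where
    "q = (\<Sum>\<alpha>\<in>multi_indices k. smult (c \<alpha>) (\<Prod>i\<in>UNIV. [:a $ i, d $ i:] ^ \<alpha> i))"
  have q: "poly q t = p (a + t *\<^sub>R d)" for t
    by (simp add: q_def c poly_sum poly_prod monomial_def algebra_simps)
  define \<delta> where "\<delta> = \<epsilon> / (norm d + 1)"
  have "\<delta> > 0" using \<open>\<epsilon> > 0\<close> by (simp add: \<delta>_def add_nonneg_pos)
  have "poly q t = 0" if "t \<in> {0<..<\<delta>}" for t
  proof -
    have "t * (norm d + 1) < \<epsilon>"
      using that by (simp add: \<delta>_def pos_less_divide_eq add_nonneg_pos)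
    then have "t * norm d < \<epsilon>" using that by (simp add: distrib_left)
    then show ?thesis unfolding q using that by (intro zero) (simp add: dist_norm)
  qed
  then have "{0<..<\<delta>} \<subseteq> {t. poly q t = 0}" by blast
  moreover have "infinite {0<..<\<delta>}" using \<open>\<delta> > 0\<close> by simp
  ultimately have "q = 0" using poly_roots_finite finite_subset by blast
  then have "p (a + 1 *\<^sub>R d) = 0" using q[of 1] by simp
  then show "p x = 0" by (simp add: d_def)
qed

section \<open>Cells and faces of a mesh\<close>

text \<open>The hypothesis \<open>supp\<close> says that \<open>m\<close> charges every relative neighbourhood of every point of \<open>A\<close>: a
  continuous function that is nonzero somewhere on \<open>A\<close> is nonzero on a set of positive measure. It is
  applied to cells, to faces and to the time interval.\<close>

lemma AE_zero_continuous_imp_zero: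
  fixes f :: "'a::metric_space \<Rightarrow> real"
  assumes ae: "AE x in m. f x = 0" and cont: "continuous_on A f"
    and supp: "\<And>x \<epsilon>. x \<in> A \<Longrightarrow> \<epsilon> > 0 \<Longrightarrow> \<exists>S\<in>sets m. S \<subseteq> ball x \<epsilon> \<inter> A \<and> S \<notin> null_sets m"
    and x: "x \<in> A"
  shows "f x = 0"
proof (rule ccontr)
  assume nz: "f x \<noteq> 0"
  then obtain \<delta> where \<delta>: "\<delta> > 0" "\<And>y. y \<in> A \<Longrightarrow> dist y x < \<delta> \<Longrightarrow> dist (f y) (f x) < \<bar>f x\<bar>"
    using cont x unfolding continuous_on_iff by (meson zero_less_abs_iff)
  obtain S where S: "S \<in> sets m" "S \<subseteq> ball x \<delta> \<inter> A" "S \<notin> null_sets m"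
    using supp[OF x \<delta>(1)] by blast
  have nzS: "f y \<noteq> 0" if "y \<in> S" for y
  proof -
    have "dist (f y) (f x) < \<bar>f x\<bar>" using that S(2) by (intro \<delta>(2)) (auto simp: dist_commute)
    then show ?thesis by (auto simp: dist_real_def)
  qed
  have "AE y in m. y \<notin> S"
    by (rule eventually_mono[OF ae]) (use nzS in blast)
  then show False using S AE_iff_null_sets by blast
qed

lemma open_nonempty_not_null_lborel:
  fixes U :: "'a::euclidean_space set"
  assumes "open U" "U \<noteq> {}" "U \<subseteq> S"
  shows "S \<notin> null_sets lborel"
proof
  assume "S \<in> null_sets lborel"
  then have "S \<in> null_sets lebesgue" by (rule null_sets_completionI)
  then have "negligible U"
    using assms(3) negligible_iff_null_sets negligible_subset by blast
  then show False using open_not_negligible assms by blast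
qed

lemma polyhedral_compact:
  assumes "polyhedral S"
  shows "compact S"
proof -
  obtain F where "finite F" "S = \<Union>F" "\<forall>P\<in>F. polytope P" using assms unfolding polyhedral_def by blast
  then show ?thesis using polytope_imp_compact by (auto intro: compact_Union)
qed

lemma polyhedral_polytope_at:
  assumes "polyhedral S" "x \<in> S"
  obtains P where "polytope P" "aff_dim P = aff_dim S" "P \<subseteq> S" "x \<in> P"
proof -
  obtain F where F: "S = \<Union>F" "\<forall>P\<in>F. polytope P \<and> aff_dim P = aff_dim S"
    using assms(1) unfolding polyhedral_def by blast
  obtain P where "P \<in> F" "x \<in> P" using assms(2) F(1) by blast
  then show ?thesis using F by (intro that[of P]) auto
qed

lemma polyhedral_full_dim_interior:
  fixes S :: "'a::euclidean_space set"
  assumes "polyhedral S" "aff_dim S = int DIM('a)"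
  shows "interior S \<noteq> {}"
proof -
  obtain x where x: "x \<in> S" using assms(1) by (auto simp: polyhedral_def)
  obtain P where P: "polytope P" "aff_dim P = int DIM('a)" "P \<subseteq> S" "x \<in> P"
    using polyhedral_polytope_at[OF assms(1) x] assms(2) by metis
  have "interior P = rel_interior P" by (rule interior_rel_interior[OF P(2), symmetric])
  also have "rel_interior P \<noteq> {}"
    using P(4) rel_interior_eq_empty[OF polytope_imp_convex[OF P(1)]] by blast
  finally have "interior P \<noteq> {}" .
  then show ?thesis using P(3) interior_mono by blast
qed

lemma is_meshD:
  fixes M :: "'a::euclidean_space mesh"
  assumes "is_mesh \<Omega> M"
  shows "finite (cells M)" "finite (faces M)"
    "\<And>T. T \<in> cells M \<Longrightarrow> polyhedral T" "\<And>T. T \<in> cells M \<Longrightarrow> aff_dim T = int DIM('a)"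
    "\<And>e. e \<in> faces M \<Longrightarrow> polyhedral e" "\<And>e. e \<in> faces M \<Longrightarrow> aff_dim e = int DIM('a) - 1"
    "\<And>e. e \<in> faces M \<Longrightarrow> is_unit_normal e (nrm M e)"
    "\<And>e. e \<in> faces M \<Longrightarrow> \<exists>T\<in>cells M. e \<in> cell_faces M T"
    "\<And>T e. T \<in> cells M \<Longrightarrow> e \<in> cell_faces M T \<Longrightarrow> \<exists>n. is_outward_normal T e n"
  using assms by (simp_all add: is_mesh_def)

lemma cells_compact: "is_mesh \<Omega> M \<Longrightarrow> T \<in> cells M \<Longrightarrow> compact T"
  by (intro polyhedral_compact is_meshD)

lemma cells_interior: "is_mesh \<Omega> M \<Longrightarrow> T \<in> cells M \<Longrightarrow> interior T \<noteq> {}"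
  by (intro polyhedral_full_dim_interior is_meshD)

lemma cells_diameter_pos:
  assumes "is_mesh \<Omega> M" "T \<in> cells M"
  shows "diameter T > 0"
proof -
  obtain x \<epsilon> where x: "\<epsilon> > 0" "cball x \<epsilon> \<subseteq> T"
    using cells_interior[OF assms] mem_interior_cball by blast
  then have "diameter (cball x \<epsilon>) \<le> diameter T"
    using cells_compact[OF assms] compact_imp_bounded diameter_subset by blast
  then show ?thesis using x(1) by simp
qed

lemma continuous_in_L2_cell:
  fixes f :: "'a::euclidean_space \<Rightarrow> real"
  assumes "compact T" "continuous_on T f"
  shows "f \<in> L2 (lebesgue_on T)"
proof -
  have T: "T \<in> sets lebesgue" using assms(1) by (simp add: lmeasurable_compact fmeasurableD)
  have "f \<in> borel_measurable (lebesgue_on T)"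
    using continuous_imp_measurable_on_sets_lebesgue[OF assms(2) T] .
  moreover have "integrable (lebesgue_on T) (\<lambda>x. (f x)\<^sup>2)"
  proof -
    have "integrable lborel (\<lambda>x. indicator T x *\<^sub>R (f x)\<^sup>2)"
      using assms by (intro borel_integrable_compact continuous_intros)
    then have "integrable lebesgue (\<lambda>x. indicator T x *\<^sub>R (f x)\<^sup>2)"
      by (simp add: integrable_completion borel_measurable_integrable)
    then show ?thesis using T by (simp add: integrable_restrict_space)
  qed
  ultimately show ?thesis by (simp add: L2_def)
qed

lemma poly_space_L2_cell:
  assumes "is_mesh \<Omega> M" "T \<in> cells M"
  shows "poly_space k \<subseteq> L2 (lebesgue_on T)"
  using continuous_in_L2_cell cells_compact[OF assms] poly_space_continuous by blast

lemma lebesgue_on_charges_interior: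
  fixes S :: "'a::euclidean_space set"
  assumes S: "S \<in> sets lebesgue" and x: "x \<in> interior S" and \<epsilon>: "\<epsilon> > 0"
  shows "\<exists>V\<in>sets (lebesgue_on S). V \<subseteq> ball x \<epsilon> \<inter> interior S \<and> V \<notin> null_sets (lebesgue_on S)"
proof -
  let ?V = "ball x \<epsilon> \<inter> interior S"
  have "?V \<notin> null_sets lebesgue"
  proof
    assume "?V \<in> null_sets lebesgue"
    then have "negligible ?V" using negligible_iff_null_sets by blast
    moreover have "open ?V" "x \<in> ?V" using x \<epsilon> by auto
    ultimately show False using open_not_negligible by blast
  qed
  moreover have "?V \<subseteq> S" using interior_subset by blast
  moreover have "?V \<in> sets lebesgue" by auto
  ultimately show ?thesis
    using S by (intro bexI[of _ ?V]) (auto simp: null_sets_restrict_space sets_restrict_space_iff)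
qed

lemma poly_space_definite_cell:
  assumes M: "is_mesh \<Omega> M" "T \<in> cells M" and p: "p \<in> poly_space k" "L2_norm (lebesgue_on T) p = 0"
  shows "p = (\<lambda>x. 0)"
proof -
  have T: "T \<in> sets lebesgue" using cells_compact[OF M] by (simp add: lmeasurable_compact fmeasurableD)
  obtain a \<epsilon> where a: "\<epsilon> > 0" "ball a \<epsilon> \<subseteq> interior T"
    using cells_interior[OF M] open_contains_ball[of "interior T"] open_interior by blast
  have ae: "AE x in lebesgue_on T. p x = 0"
    using p poly_space_L2_cell[OF M] by (intro L2_norm_eq_0_AE) auto
  have "p x = 0" if "x \<in> interior T" for x
    by (rule AE_zero_continuous_imp_zero[OF ae poly_space_continuous[OF p(1)]
        lebesgue_on_charges_interior[OF T] that])
  then show ?thesis using a by (intro poly_space_vanishing_on_ball[OF p(1) a(1)]) auto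
qed

lemma poly_space_orthonormal_basis:
  assumes M: "is_mesh \<Omega> M" "T \<in> cells M"
  shows "\<exists>B. orthonormal_basis (lebesgue_on T) (poly_space k) B"
proof (rule orthonormal_basis_exists[OF function_subspace_poly_space poly_space_L2_cell[OF M]])
  show "finite (monomial ` multi_indices k :: (real^'a \<Rightarrow> real) set)"
    by (simp add: finite_multi_indices)
  show "monomial ` multi_indices k \<subseteq> poly_space k" by (auto intro: monomial_in_poly_space)
  fix f :: "real^'a \<Rightarrow> real" assume f: "f \<in> poly_space k"
  then show "f = (\<lambda>x. 0)" if "L2_norm (lebesgue_on T) f = 0"
    using poly_space_definite_cell[OF M] that by blast
  obtain c where c: "f = (\<lambda>x. \<Sum>\<alpha>\<in>multi_indices k. c \<alpha> * monomial \<alpha> x)"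
    using f unfolding poly_space_eq by blast
  define d where "d g = (\<Sum>\<alpha>\<in>{\<alpha>\<in>multi_indices k. monomial \<alpha> = g}. c \<alpha>)" for g :: "real^'a \<Rightarrow> real"
  have "f x = (\<Sum>g\<in>monomial ` multi_indices k. d g * g x)" for x
  proof -
    have "f x = (\<Sum>g\<in>monomial ` multi_indices k. \<Sum>\<alpha>\<in>{\<alpha>\<in>multi_indices k. monomial \<alpha> = g}. c \<alpha> * monomial \<alpha> x)"
      unfolding c by (rule sum.image_gen) (rule finite_multi_indices)
    also have "\<dots> = (\<Sum>g\<in>monomial ` multi_indices k. d g * g x)"
      by (intro sum.cong refl) (simp add: d_def sum_distrib_right)
    finally show ?thesis .
  qed
  then show "\<exists>c. f = (\<lambda>x. \<Sum>g\<in>monomial ` multi_indices k. c g * g x)" by blast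
qed

lemma face_facts:
  fixes M :: "'a::euclidean_space mesh"
  assumes "is_mesh \<Omega> M" "e \<in> faces M"
  shows "polyhedral e" "compact e" "e \<noteq> {}" "aff_dim e = int DIM('a) - 1" "is_unit_normal e (nrm M e)"
  using is_meshD(5-7)[OF assms] polyhedral_compact polyhedral_def by auto

text \<open>Both sides are affine sets of dimension \<open>d - 1\<close>, one contained in the other.\<close>

lemma affine_hull_face:
  fixes e :: "'a::euclidean_space set"
  assumes "is_unit_normal e n" "aff_dim e = int DIM('a) - 1" "y \<in> e"
  shows "affine hull e = {x. n \<bullet> x = n \<bullet> y}"
proof -
  have sub: "e \<subseteq> {x. n \<bullet> x = n \<bullet> y}"
  proof
    fix x assume "x \<in> e"
    then have "n \<bullet> (x - y) = 0" using assms(1,3) unfolding is_unit_normal_def by blast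
    then show "x \<in> {x. n \<bullet> x = n \<bullet> y}" by (simp add: inner_diff_right)
  qed
  have "n \<noteq> 0" using assms(1) by (auto simp: is_unit_normal_def)
  then have "aff_dim e = aff_dim {x. n \<bullet> x = n \<bullet> y}" using assms(2) by simp
  then show ?thesis
    using aff_dim_eq_full_gen[OF sub] hull_same[of affine, OF affine_hyperplane[of n "n \<bullet> y"]] by simp
qed

text \<open>The component \<open>z\<close> of \<open>n'\<close> orthogonal to \<open>n\<close> is a direction of the hyperplane of \<open>e\<close>, so \<open>n'\<close> is
  orthogonal to it as well.\<close>

lemma unit_normals_parallel:
  fixes e :: "'a::euclidean_space set"
  assumes n: "is_unit_normal e n" and n': "is_unit_normal e n'"
    and e: "aff_dim e = int DIM('a) - 1" "e \<noteq> {}"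
  shows "(n \<bullet> n')\<^sup>2 = 1"
proof -
  obtain y where y: "y \<in> e" using e by blast
  have unit: "n \<bullet> n = 1" "n' \<bullet> n' = 1"
    using n n' by (auto simp: is_unit_normal_def norm_eq_1)
  define z where "z = n' - (n \<bullet> n') *\<^sub>R n"
  have "n \<bullet> z = 0" using unit by (simp add: z_def inner_diff_right)
  then have "y + z \<in> {x. n \<bullet> x = n \<bullet> y}" by (simp add: inner_add_right)
  then have "y + z \<in> {x. n' \<bullet> x = n' \<bullet> y}"
    using affine_hull_face[OF n e(1) y] affine_hull_face[OF n' e(1) y] by simp
  then have "n' \<bullet> z = 0" by (simp add: inner_add_right)
  then show ?thesis
    using unit by (simp add: z_def inner_diff_right inner_commute power2_eq_square)
qed

text \<open>If \<open>n' = - n\<close>, a point slightly off the face on the side of \<open>- n\<close> would be both inside and outside \<open>T\<close>.\<close>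

lemma is_outward_normal_unique:
  fixes e :: "'a::euclidean_space set"
  assumes n: "is_outward_normal T e n" and n': "is_outward_normal T e n'"
    and e: "aff_dim e = int DIM('a) - 1" "rel_interior e \<noteq> {}"
  shows "n = n'"
proof -
  have u: "is_unit_normal e n" "is_unit_normal e n'"
    using n n' by (auto simp: is_outward_normal_def)
  have "e \<noteq> {}" using e(2) by auto
  then have "(n \<bullet> n')\<^sup>2 = 1" using unit_normals_parallel u e(1) by blast
  moreover have unit: "n \<bullet> n = 1" "n' \<bullet> n' = 1"
    using u by (auto simp: is_unit_normal_def norm_eq_1)
  moreover have "n \<bullet> n' \<noteq> -1"
  proof
    assume "n \<bullet> n' = -1"
    then have "(n + n') \<bullet> (n + n') = 0"
      using unit by (simp add: inner_add_left inner_add_right inner_commute)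
    then have neg: "n' = - n" by (simp add: add_eq_0_iff)
    obtain x where x: "x \<in> rel_interior e" using e(2) by blast
    obtain \<epsilon> where \<epsilon>: "\<epsilon> > 0" "\<And>s. 0 < s \<and> s < \<epsilon> \<Longrightarrow> x - s *\<^sub>R n \<in> T"
      using n x unfolding is_outward_normal_def by meson
    obtain \<epsilon>' where \<epsilon>': "\<epsilon>' > 0" "\<And>s. 0 < s \<and> s < \<epsilon>' \<Longrightarrow> x + s *\<^sub>R n' \<notin> T"
      using n' x unfolding is_outward_normal_def by meson
    define s where "s = min \<epsilon> \<epsilon>' / 2"
    have "0 < s" "s < \<epsilon>" "s < \<epsilon>'" using \<epsilon>(1) \<epsilon>'(1) by (auto simp: s_def)
    then have "x - s *\<^sub>R n \<in> T" "x + s *\<^sub>R n' \<notin> T" using \<epsilon>(2) \<epsilon>'(2) by auto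
    then show False using neg by simp
  qed
  ultimately have "n \<bullet> n' = 1" by (simp add: power2_eq_1_iff)
  then have "(n - n') \<bullet> (n - n') = 0"
    using unit by (simp add: inner_diff_left inner_diff_right inner_commute)
  then show ?thesis by simp
qed

lemma polyhedral_rel_interior_nonempty:
  assumes "polyhedral e"
  shows "rel_interior e \<noteq> {}"
proof -
  obtain x where x: "x \<in> e" using assms(1) by (auto simp: polyhedral_def)
  obtain P where P: "polytope P" "aff_dim P = aff_dim e" "P \<subseteq> e" "x \<in> P"
    using polyhedral_polytope_at[OF assms(1) x] by metis
  have "affine hull P = affine hull e" using aff_dim_eq_full_gen[OF P(3)] P(2) by blast
  then have "rel_interior P \<subseteq> rel_interior e"
    using P(3) by (intro subset_rel_interior) auto
  then show ?thesis
    using P(4) rel_interior_eq_empty[OF polytope_imp_convex[OF P(1)]] by blast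
qed

lemma outward_normal_inner_nrm:
  assumes M: "is_mesh \<Omega> M" "T \<in> cells M" "e \<in> cell_faces M T"
  shows "(nrm M e \<bullet> outward_normal T e)\<^sup>2 = 1"
proof -
  have e: "e \<in> faces M" using M(3) by (simp add: cell_faces_def)
  note ef = face_facts[OF M(1) e]
  obtain n where n: "is_outward_normal T e n" using is_meshD(9)[OF M] by blast
  have "is_outward_normal T e (outward_normal T e)"
    unfolding outward_normal_def
    using n is_outward_normal_unique ef(4) polyhedral_rel_interior_nonempty[OF ef(1)]
    by (intro theI'[of "is_outward_normal T e"]) blast
  then have "is_unit_normal e (outward_normal T e)" by (simp add: is_outward_normal_def)
  then show ?thesis using unit_normals_parallel ef by blast
qed

text \<open>The two ingredients of the surface measure: the right prism over \<open>e\<close>, and the orthogonal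
  projection onto the hyperplane through an arbitrary point of \<open>e\<close>.\<close>

definition face_prism :: "'a::euclidean_space set \<Rightarrow> 'a \<Rightarrow> 'a set" where
  "face_prism e n = {y + s *\<^sub>R n | y s. y \<in> e \<and> 0 \<le> s \<and> s \<le> 1}"

definition face_projection :: "'a::euclidean_space set \<Rightarrow> 'a \<Rightarrow> 'a \<Rightarrow> 'a" where
  "face_projection e n x = x - ((x - (SOME y. y \<in> e)) \<bullet> n) *\<^sub>R n"

lemma face_measure_eq:
  "face_measure e n = distr (restrict_space lborel (face_prism e n)) borel (face_projection e n)"
  by (simp add: face_measure_def face_prism_def face_projection_def[abs_def] Let_def)

lemma compact_face_prism:
  assumes "compact e"
  shows "compact (face_prism e n)"
proof -
  have "face_prism e n = (\<lambda>p. fst p + snd p *\<^sub>R n) ` (e \<times> {0..1})"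
    unfolding face_prism_def by force
  moreover have "compact ((\<lambda>p. fst p + snd p *\<^sub>R n) ` (e \<times> {0..1::real}))"
    by (intro compact_continuous_image compact_Times compact_Icc assms continuous_intros)
  ultimately show ?thesis by simp
qed

lemma continuous_face_projection: "continuous_on S (face_projection e n)"
  unfolding face_projection_def[abs_def] by (intro continuous_intros)

lemma measurable_face_projection:
  "face_projection e n \<in> measurable (restrict_space lborel (face_prism e n)) borel"
proof -
  have "face_projection e n \<in> borel_measurable borel"
    by (intro borel_measurable_continuous_onI continuous_face_projection)
  then show ?thesis by (simp add: measurable_restrict_space1)
qed

lemma bounded_by_continuous_in_L2_face:
  fixes f g :: "'a::euclidean_space \<Rightarrow> real"
  assumes "compact e" "g \<in> borel_measurable borel" "continuous_on UNIV f" "\<And>x. \<bar>g x\<bar> \<le> \<bar>f x\<bar>"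
  shows "g \<in> L2 (face_measure e n)"
proof -
  let ?m = "restrict_space lborel (face_prism e n)"
  have prism: "face_prism e n \<in> sets borel" using compact_face_prism[OF assms(1)] by (simp add: borel_compact)
  have f: "f \<in> borel_measurable borel" by (intro borel_measurable_continuous_onI assms)
  have c: "continuous_on (face_prism e n) (\<lambda>x. (f (face_projection e n x))\<^sup>2)"
    by (intro continuous_intros continuous_on_compose2[OF assms(3)] continuous_face_projection) auto
  have "integrable lborel (\<lambda>x. indicator (face_prism e n) x *\<^sub>R (f (face_projection e n x))\<^sup>2)"
    by (intro borel_integrable_compact compact_face_prism assms c)
  then have "integrable ?m (\<lambda>x. (f (face_projection e n x))\<^sup>2)"
    using prism by (simp add: integrable_restrict_space)
  then have "integrable (face_measure e n) (\<lambda>x. (f x)\<^sup>2)"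
    unfolding face_measure_eq using f
    by (subst integrable_distr_eq[OF measurable_face_projection]) auto
  then have "integrable (face_measure e n) (\<lambda>x. (g x)\<^sup>2)"
    by (rule Bochner_Integration.integrable_bound)
       (use assms(2,4) in \<open>auto simp: face_measure_eq abs_le_square_iff\<close>)
  then show ?thesis using assms(2) by (simp add: L2_def face_measure_eq)
qed

lemma poly_space_L2_face:
  assumes "is_mesh \<Omega> M" "e \<in> faces M"
  shows "poly_space k \<subseteq> L2 (fmeas M e)"
  by (auto intro!: bounded_by_continuous_in_L2_face[OF face_facts(2)[OF assms]]
      borel_measurable_continuous_onI poly_space_continuous)

lemma P_face_L2:
  assumes "is_mesh \<Omega> M" "e \<in> faces M"
  shows "P_face k e \<subseteq> L2 (fmeas M e)"
proof
  fix v assume "v \<in> P_face k e"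
  then obtain p where p: "p \<in> poly_space k" "v = (\<lambda>x. if x \<in> e then p x else 0)"
    by (auto simp: P_face_def)
  have e: "e \<in> sets borel" using face_facts(2)[OF assms] by (simp add: borel_compact)
  have "p \<in> borel_measurable borel"
    by (intro borel_measurable_continuous_onI poly_space_continuous[OF p(1)])
  then have "v \<in> borel_measurable borel" unfolding p(2) using e by (intro measurable_If_set) auto
  then show "v \<in> L2 (fmeas M e)"
    using p by (intro bounded_by_continuous_in_L2_face[OF face_facts(2)[OF assms] _ poly_space_continuous[OF p(1)]]) auto
qed

text \<open>A point of a face lies in a polytope \<open>P\<close> with the dimension of the face, hence close to a relatively
  interior point \<open>y\<close> of \<open>P\<close>. A small disc \<open>S\<close> around \<open>y\<close> in the hyperplane lies in \<open>P\<close>, and the open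
  cylinder \<open>U\<close> of height 1 over that disc lies in the prism and projects into \<open>S\<close>; so \<open>S\<close> has
  positive surface measure.\<close>

lemma face_measure_charges:
  fixes e :: "'a::euclidean_space set"
  assumes e: "polyhedral e" "aff_dim e = int DIM('a) - 1" and n: "is_unit_normal e n"
    and x: "x \<in> e" and \<epsilon>: "\<epsilon> > 0"
  shows "\<exists>S\<in>sets (face_measure e n). S \<subseteq> ball x \<epsilon> \<inter> e \<and> S \<notin> null_sets (face_measure e n)"
proof -
  obtain P where P: "polytope P" "aff_dim P = aff_dim e" "P \<subseteq> e" "x \<in> P"
    using polyhedral_polytope_at[OF e(1) x] by metis
  have hull: "affine hull P = affine hull e" using aff_dim_eq_full_gen[OF P(3)] P(2) by blast
  have "x \<in> closure (rel_interior P)"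
    using convex_closure_rel_interior[OF polytope_imp_convex[OF P(1)]] P(4) closure_subset by blast
  then obtain y where y: "y \<in> rel_interior P" "dist y x < \<epsilon> / 2"
    using \<epsilon> by (meson closure_approachable half_gt_zero)
  then obtain \<delta>0 where \<delta>0: "\<delta>0 > 0" "ball y \<delta>0 \<inter> affine hull P \<subseteq> P" "y \<in> P"
    using mem_rel_interior_ball by blast
  define \<delta> where "\<delta> = min \<delta>0 (\<epsilon> / 2)"
  have \<delta>: "\<delta> > 0" "\<delta> \<le> \<delta>0" "\<delta> \<le> \<epsilon> / 2" using \<delta>0(1) \<epsilon> by (auto simp: \<delta>_def)
  define S where "S = ball y \<delta> \<inter> affine hull e"
  have SP: "S \<subseteq> P" using \<delta>0(2) \<delta>(2) hull by (auto simp: S_def)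
  have Sx: "S \<subseteq> ball x \<epsilon>"
  proof
    fix z assume "z \<in> S"
    then have "dist y z < \<epsilon> / 2" using \<delta>(3) by (simp add: S_def)
    then show "z \<in> ball x \<epsilon>" using y(2) dist_triangle[of x z y] by (simp add: dist_commute)
  qed
  have "closed (affine hull e)" by (rule closed_affine_hull)
  then have Sb: "S \<in> sets borel" by (simp add: S_def borel_closed)
  define y0 where "y0 = (SOME y. y \<in> e)"
  have y0: "y0 \<in> e" unfolding y0_def using x by (rule someI)
  have hyp: "affine hull e = {x. n \<bullet> x = n \<bullet> y0}" by (rule affine_hull_face[OF n e(2) y0])
  have proj: "face_projection e n z = z - ((z - y0) \<bullet> n) *\<^sub>R n" for z
    by (simp add: face_projection_def y0_def)
  have unit: "n \<bullet> n = 1" using n by (simp add: is_unit_normal_def norm_eq_1)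
  have proj_hull: "face_projection e n z \<in> affine hull e" for z
    unfolding hyp proj using unit by (simp add: inner_diff_right inner_diff_left inner_commute)
  define U where "U = {z. face_projection e n z \<in> ball y \<delta>} \<inter> {z. (z - y0) \<bullet> n \<in> {0<..<1}}"
  have "open U" unfolding U_def
    by (intro open_Int open_vimage[unfolded vimage_def] continuous_face_projection continuous_intros) auto
  moreover have "U \<noteq> {}"
  proof -
    have "y \<in> affine hull e" 
      by (rule hull_inc) (use \<delta>0(3) P(3) in blast)
    then have yn: "(y - y0) \<bullet> n = 0" unfolding hyp by (simp add: inner_diff_right inner_commute[of _ n])
    then have half: "(y + (1/2) *\<^sub>R n - y0) \<bullet> n = 1/2"
      using unit by (simp add: inner_diff_left inner_add_left)
    have "face_projection e n (y + (1/2) *\<^sub>R n) = y" unfolding proj half by simp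
    then have "y + (1/2) *\<^sub>R n \<in> U" using \<delta>(1) half by (simp add: U_def)
    then show ?thesis by blast
  qed
  moreover have "U \<subseteq> face_projection e n -` S \<inter> face_prism e n"
  proof
    fix z assume z: "z \<in> U"
    then have "face_projection e n z \<in> S" using proj_hull by (simp add: U_def S_def)
    moreover have "z \<in> face_prism e n"
      unfolding face_prism_def using calculation z SP P(3)
      by (auto intro!: exI[of _ "face_projection e n z"] exI[of _ "(z - y0) \<bullet> n"] simp: proj U_def)
    ultimately show "z \<in> face_projection e n -` S \<inter> face_prism e n" by simp
  qed
  ultimately have nn: "face_projection e n -` S \<inter> face_prism e n \<notin> null_sets lborel"
    by (rule open_nonempty_not_null_lborel)
  have prism: "face_prism e n \<in> sets borel"
    using compact_face_prism[OF polyhedral_compact[OF e(1)]] by (simp add: borel_compact)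
  have "S \<notin> null_sets (face_measure e n)"
  proof
    assume "S \<in> null_sets (face_measure e n)"
    then have "face_projection e n -` S \<inter> face_prism e n \<in> null_sets (restrict_space lborel (face_prism e n))"
      unfolding face_measure_eq
      by (subst (asm) null_sets_distr_iff[OF measurable_face_projection]) (simp add: space_restrict_space)
    then show False using nn prism by (simp add: null_sets_restrict_space)
  qed
  then show ?thesis using Sb SP Sx P(3) by (intro bexI[of _ S]) (auto simp: face_measure_eq)
qed

lemma P_face_definite:
  assumes M: "is_mesh \<Omega> M" "e \<in> faces M" and v: "v \<in> P_face k e" "L2_norm (fmeas M e) v = 0"
  shows "v = (\<lambda>x. 0)"
proof -
  obtain p where p: "p \<in> poly_space k" "v = (\<lambda>x. if x \<in> e then p x else 0)"
    using v(1) by (auto simp: P_face_def)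
  have ae: "AE x in fmeas M e. v x = 0"
    using v P_face_L2[OF M] by (intro L2_norm_eq_0_AE) auto
  have "continuous_on e v"
    using poly_space_continuous[OF p(1), of e] continuous_on_cong[of e e v p] p(2) by auto
  then have "v x = 0" if "x \<in> e" for x
    using AE_zero_continuous_imp_zero[OF ae _ face_measure_charges that] face_facts[OF M] by blast
  then show ?thesis using p(2) by auto
qed

section \<open>The weak Laplacian and its bilinear form\<close>

lemma v0_diff: "v0 (u - v) T = (\<lambda>x. v0 u T x - v0 v T x)"
  and vb_diff: "vb (u - v) T = (\<lambda>x. vb u T x - vb v T x)"
  and vn_diff: "vn (u - v) T = (\<lambda>x. vn u T x - vn v T x)"
  by (simp_all add: v0_def vb_def vn_def fun_eq_iff)

lemma function_subspace_P_face: "function_subspace (P_face k e)"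
  unfolding function_subspace_def
proof (intro conjI ballI allI)
  show "(\<lambda>x. 0) \<in> P_face k e"
    unfolding P_face_def using poly_space_zero by (auto simp: fun_eq_iff intro!: exI[of _ "\<lambda>x. 0"])
  fix f g and c :: real assume "f \<in> P_face k e" "g \<in> P_face k e"
  then obtain p q where pq: "p \<in> poly_space k" "q \<in> poly_space k"
      "f = (\<lambda>x. if x \<in> e then p x else 0)" "g = (\<lambda>x. if x \<in> e then q x else 0)"
    by (auto simp: P_face_def)
  have "(\<lambda>x. c * p x + q x) \<in> poly_space k"
    by (intro function_subspace_lincomb[OF function_subspace_poly_space] pq)
  then show "(\<lambda>x. c * f x + g x) \<in> P_face k e"
    unfolding P_face_def by (auto simp: pq fun_eq_iff intro!: exI[of _ "\<lambda>x. c * p x + q x"])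
qed

lemma P_face_zero: "(\<lambda>x. 0) \<in> P_face k e"
  using function_subspace_P_face unfolding function_subspace_def by blast

lemma VhD:
  assumes "v \<in> Vh M k"
  shows "\<And>T. T \<in> cells M \<Longrightarrow> v0 v T \<in> poly_space k"
    "\<And>e. e \<in> faces M \<Longrightarrow> vb v e \<in> P_face k e" "\<And>e. e \<in> faces M \<Longrightarrow> vn v e \<in> P_face (k - 1) e"
    "\<And>T. T \<notin> cells M \<Longrightarrow> v0 v T = (\<lambda>x. 0)"
    "\<And>e. e \<notin> faces M \<Longrightarrow> vb v e = (\<lambda>x. 0)" "\<And>e. e \<notin> faces M \<Longrightarrow> vn v e = (\<lambda>x. 0)"
  using assms unfolding Vh_def zero_fun_def by (auto split: if_splits)

lemma VhI:
  assumes "\<And>T. T \<in> cells M \<Longrightarrow> v0 v T \<in> poly_space k" "\<And>T. T \<notin> cells M \<Longrightarrow> v0 v T = (\<lambda>x. 0)"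
    "\<And>e. e \<in> faces M \<Longrightarrow> vb v e \<in> P_face k e" "\<And>e. e \<notin> faces M \<Longrightarrow> vb v e = (\<lambda>x. 0)"
    "\<And>e. e \<in> faces M \<Longrightarrow> vn v e \<in> P_face (k - 1) e" "\<And>e. e \<notin> faces M \<Longrightarrow> vn v e = (\<lambda>x. 0)"
  shows "v \<in> Vh M k"
  using assms unfolding Vh_def zero_fun_def by auto

lemma Vh_eq_zero:
  assumes v: "v \<in> Vh M k" and "\<And>T. T \<in> cells M \<Longrightarrow> v0 v T = (\<lambda>x. 0)"
    "\<And>e. e \<in> faces M \<Longrightarrow> vb v e = (\<lambda>x. 0)" "\<And>e. e \<in> faces M \<Longrightarrow> vn v e = (\<lambda>x. 0)"
  shows "v = 0"
proof -
  have "v0 v T = (\<lambda>x. 0)" "vb v e = (\<lambda>x. 0)" "vn v e = (\<lambda>x. 0)" for T e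
    using assms(2-4) VhD(4-6)[OF v] by blast+
  then have "v0 v = 0" "vb v = 0" "vn v = 0" by (simp_all add: zero_fun_def fun_eq_iff)
  then show ?thesis by (simp add: v0_def vb_def vn_def prod_eq_iff)
qed

lemma Vh_diff:
  assumes "u \<in> Vh M k" "v \<in> Vh M k"
  shows "u - v \<in> Vh M k"
  using VhD[OF assms(1)] VhD[OF assms(2)]
  by (intro VhI) (auto simp: v0_diff vb_diff vn_diff
      intro: function_subspace_diff[OF function_subspace_poly_space]
        function_subspace_diff[OF function_subspace_P_face])

lemma Vh0_subset: "v \<in> Vh0 \<Omega> M k \<Longrightarrow> v \<in> Vh M k"
  by (simp add: Vh0_def)

lemma Vh0_diff:
  assumes "u \<in> Vh0 \<Omega> M k" "v \<in> Vh0 \<Omega> M k"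
  shows "u - v \<in> Vh0 \<Omega> M k"
  using assms Vh_diff[of u M k v] unfolding Vh0_def zero_fun_def by (auto simp: vb_diff vn_diff)

lemma cell_faces_subset: "e \<in> cell_faces M T \<Longrightarrow> e \<in> faces M"
  by (simp add: cell_faces_def)

lemma finite_cell_faces: "is_mesh \<Omega> M \<Longrightarrow> finite (cell_faces M T)"
  using is_meshD(2)[of \<Omega> M] by (simp add: cell_faces_def)

lemma Vh_L2:
  assumes M: "is_mesh \<Omega> M" and v: "v \<in> Vh M k"
  shows "\<And>T. T \<in> cells M \<Longrightarrow> v0 v T \<in> L2 (lebesgue_on T)"
    "\<And>e. e \<in> faces M \<Longrightarrow> vb v e \<in> L2 (fmeas M e)"
    "\<And>e. e \<in> faces M \<Longrightarrow> vn v e \<in> L2 (fmeas M e)"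
  using poly_space_L2_cell[OF M] P_face_L2[OF M] VhD(1-3)[OF v] by blast+

lemma component_le_wg_norm:
  assumes M: "is_mesh \<Omega> M"
  shows "T \<in> cells M \<Longrightarrow> L2_norm (lebesgue_on T) (v0 v T) \<le> wg_norm M v"
    and "e \<in> faces M \<Longrightarrow> L2_norm (fmeas M e) (vb v e) \<le> wg_norm M v"
    and "e \<in> faces M \<Longrightarrow> L2_norm (fmeas M e) (vn v e) \<le> wg_norm M v"
proof -
  let ?c = "\<Sum>T\<in>cells M. (L2_norm (lebesgue_on T) (v0 v T))\<^sup>2"
  let ?f = "\<Sum>e\<in>faces M. (L2_norm (fmeas M e) (vb v e))\<^sup>2 + (L2_norm (fmeas M e) (vn v e))\<^sup>2"
  have nonneg: "0 \<le> ?c" "0 \<le> ?f" by (auto intro!: sum_nonneg)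
  have f: "(L2_norm (fmeas M e) (vb v e))\<^sup>2 + (L2_norm (fmeas M e) (vn v e))\<^sup>2 \<le> ?f" if "e \<in> faces M"
    using that is_meshD(2)[OF M]
      member_le_sum[of e "faces M" "\<lambda>e. (L2_norm (fmeas M e) (vb v e))\<^sup>2 + (L2_norm (fmeas M e) (vn v e))\<^sup>2"]
    by simp
  show "L2_norm (lebesgue_on T) (v0 v T) \<le> wg_norm M v" if "T \<in> cells M"
    unfolding wg_norm_def
    using that is_meshD(1)[OF M] nonneg
      member_le_sum[of T "cells M" "\<lambda>T. (L2_norm (lebesgue_on T) (v0 v T))\<^sup>2"]
    by (intro real_le_rsqrt) simp
  show "L2_norm (fmeas M e) (vb v e) \<le> wg_norm M v" if "e \<in> faces M"
    unfolding wg_norm_def using f[OF that] nonneg zero_le_power2[of "L2_norm (fmeas M e) (vn v e)"]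
    by (intro real_le_rsqrt) linarith
  show "L2_norm (fmeas M e) (vn v e) \<le> wg_norm M v" if "e \<in> faces M"
    unfolding wg_norm_def using f[OF that] nonneg zero_le_power2[of "L2_norm (fmeas M e) (vb v e)"]
    by (intro real_le_rsqrt) linarith
qed

text \<open>Linear functionals that are bounded by the norm of the discrete space; additivity is stated
  for differences because it is applied to the difference of two solutions. Such a functional turns a solution into
  a continuous scalar function of time and its weak time derivative into an integrable one.\<close>

definition Vh_functional ::
    "(real^'n::finite) mesh \<Rightarrow> nat \<Rightarrow> ((real^'n) wg \<Rightarrow> real) \<Rightarrow> bool" where
  "Vh_functional M k L \<longleftrightarrow>
     (\<forall>u\<in>Vh M k. \<forall>v\<in>Vh M k. L (u - v) = L u - L v) \<and>
     (\<exists>C. \<forall>v\<in>Vh M k. \<bar>L v\<bar> \<le> C * wg_norm M v)"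

lemma Vh_functionalI:
  assumes "\<And>u v. u \<in> Vh M k \<Longrightarrow> v \<in> Vh M k \<Longrightarrow> L (u - v) = L u - L v"
    "\<And>v. v \<in> Vh M k \<Longrightarrow> \<bar>L v\<bar> \<le> C * wg_norm M v"
  shows "Vh_functional M k L"
  using assms unfolding Vh_functional_def by blast

lemma Vh_functional_diff:
  "Vh_functional M k L \<Longrightarrow> u \<in> Vh M k \<Longrightarrow> v \<in> Vh M k \<Longrightarrow> L (u - v) = L u - L v"
  by (simp add: Vh_functional_def)

lemma Vh_functional_zero: "Vh_functional M k (\<lambda>v. 0)"
  by (rule Vh_functionalI[where C = 0]) auto

lemma Vh_functional_add:
  assumes "Vh_functional M k L" "Vh_functional M k L'"
  shows "Vh_functional M k (\<lambda>v. L v + L' v)"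
proof -
  obtain C C' where C: "\<And>v. v \<in> Vh M k \<Longrightarrow> \<bar>L v\<bar> \<le> C * wg_norm M v"
      "\<And>v. v \<in> Vh M k \<Longrightarrow> \<bar>L' v\<bar> \<le> C' * wg_norm M v"
    using assms unfolding Vh_functional_def by metis
  show ?thesis
  proof (rule Vh_functionalI[where C = "C + C'"])
    show "\<bar>L v + L' v\<bar> \<le> (C + C') * wg_norm M v" if "v \<in> Vh M k" for v
      using C[OF that] abs_triangle_ineq[of "L v" "L' v"] by (simp add: distrib_right)
  qed (simp add: Vh_functional_diff[OF assms(1)] Vh_functional_diff[OF assms(2)])
qed

lemma Vh_functional_scale:
  assumes "Vh_functional M k L"
  shows "Vh_functional M k (\<lambda>v. c * L v)"
proof -
  obtain C where C: "\<And>v. v \<in> Vh M k \<Longrightarrow> \<bar>L v\<bar> \<le> C * wg_norm M v"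
    using assms unfolding Vh_functional_def by metis
  show ?thesis
  proof (rule Vh_functionalI[where C = "\<bar>c\<bar> * C"])
    show "\<bar>c * L v\<bar> \<le> \<bar>c\<bar> * C * wg_norm M v" if "v \<in> Vh M k" for v
      using mult_left_mono[OF C[OF that], of "\<bar>c\<bar>"] by (simp add: abs_mult mult.assoc)
  qed (simp add: Vh_functional_diff[OF assms] right_diff_distrib)
qed

lemma Vh_functional_sum:
  assumes "\<And>i. i \<in> I \<Longrightarrow> Vh_functional M k (L i)"
  shows "Vh_functional M k (\<lambda>v. \<Sum>i\<in>I. L i v)"
  using assms
  by (induction I rule: infinite_finite_induct) (auto intro: Vh_functional_add Vh_functional_zero)

lemma Vh_functional_components:
  assumes M: "is_mesh \<Omega> M"
  shows "T \<in> cells M \<Longrightarrow> g \<in> L2 (lebesgue_on T) \<Longrightarrow>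
      Vh_functional M k (\<lambda>v. L2_ip (lebesgue_on T) (v0 v T) g)"
    and "e \<in> faces M \<Longrightarrow> g \<in> L2 (fmeas M e) \<Longrightarrow>
      Vh_functional M k (\<lambda>v. L2_ip (fmeas M e) (vb v e) g)"
    and "e \<in> faces M \<Longrightarrow> g \<in> L2 (fmeas M e) \<Longrightarrow>
      Vh_functional M k (\<lambda>v. L2_ip (fmeas M e) (vn v e) g)"
proof -
  have general: "Vh_functional M k (\<lambda>v. L2_ip m (F v) g)"
    if "g \<in> L2 m" and F: "\<And>v. v \<in> Vh M k \<Longrightarrow> F v \<in> L2 m"
      and d: "\<And>u v. F (u - v) = (\<lambda>x. F u x - F v x)"
      and b: "\<And>v. L2_norm m (F v) \<le> wg_norm M v" for g m and F :: "(real^'a) wg \<Rightarrow> real^'a \<Rightarrow> real"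
  proof (rule Vh_functionalI[where C = "L2_norm m g"])
    show "L2_ip m (F (u - v)) g = L2_ip m (F u) g - L2_ip m (F v) g"
      if "u \<in> Vh M k" "v \<in> Vh M k" for u v
      unfolding d by (intro L2_ip_diff F that \<open>g \<in> L2 m\<close>)
    show "\<bar>L2_ip m (F v) g\<bar> \<le> L2_norm m g * wg_norm M v" if "v \<in> Vh M k" for v
    proof -
      have "\<bar>L2_ip m (F v) g\<bar> \<le> L2_norm m (F v) * L2_norm m g"
        by (intro L2_Cauchy_Schwarz F that \<open>g \<in> L2 m\<close>)
      also have "\<dots> \<le> wg_norm M v * L2_norm m g" by (intro mult_right_mono b) simp
      finally show ?thesis by (simp add: mult.commute)
    qed
  qed
  show "Vh_functional M k (\<lambda>v. L2_ip (lebesgue_on T) (v0 v T) g)"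
    if "T \<in> cells M" "g \<in> L2 (lebesgue_on T)"
    by (rule general[OF that(2) Vh_L2(1)[OF M _ that(1)] v0_diff component_le_wg_norm(1)[OF M that(1)]])
  show "Vh_functional M k (\<lambda>v. L2_ip (fmeas M e) (vb v e) g)"
    if "e \<in> faces M" "g \<in> L2 (fmeas M e)"
    by (rule general[OF that(2) Vh_L2(2)[OF M _ that(1)] vb_diff component_le_wg_norm(2)[OF M that(1)]])
  show "Vh_functional M k (\<lambda>v. L2_ip (fmeas M e) (vn v e) g)"
    if "e \<in> faces M" "g \<in> L2 (fmeas M e)"
    by (rule general[OF that(2) Vh_L2(3)[OF M _ that(1)] vn_diff component_le_wg_norm(3)[OF M that(1)]])
qed

text \<open>The right-hand side of the definition of the weak Laplacian, split into the contribution of the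
  interior component and that of the two boundary components. Both depend linearly on \<open>v\<close> and on \<open>\<phi>\<close>.\<close>

definition face_pairing :: "(real^'n::finite) mesh \<Rightarrow> (real^'n) wg \<Rightarrow> (real^'n) set \<Rightarrow> (real^'n \<Rightarrow> real) \<Rightarrow> real" where
  "face_pairing M v T \<phi> =
     (\<Sum>e\<in>cell_faces M T. (nrm M e \<bullet> outward_normal T e) * L2_ip (fmeas M e) (vn v e) \<phi>
        - L2_ip (fmeas M e) (vb v e) (\<lambda>x. grad \<phi> x \<bullet> outward_normal T e))"

definition laplacian_pairing :: "(real^'n::finite) mesh \<Rightarrow> (real^'n) wg \<Rightarrow> (real^'n) set \<Rightarrow> (real^'n \<Rightarrow> real) \<Rightarrow> real" where
  "laplacian_pairing M v T \<phi> = L2_ip (lebesgue_on T) (v0 v T) (laplacian \<phi>) + face_pairing M v T \<phi>"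

lemma weak_laplacian_eq:
  "weak_laplacian M r v T =
     (THE w. w \<in> poly_space r \<and> (\<forall>\<phi>\<in>poly_space r. L2_ip (lebesgue_on T) w \<phi> = laplacian_pairing M v T \<phi>))"
proof -
  have "L2_ip m (\<lambda>x. (f x *\<^sub>R a) \<bullet> b) \<phi> = (a \<bullet> b) * L2_ip m f \<phi>"
    for m and f \<phi> :: "real^'a \<Rightarrow> real" and a b :: "real^'a"
  proof -
    have "(\<lambda>x. ((f x *\<^sub>R a) \<bullet> b) * \<phi> x) = (\<lambda>x. (a \<bullet> b) * (f x * \<phi> x))" by (auto simp: mult_ac)
    then show ?thesis by (simp only: L2_ip_def integral_mult_right_zero)
  qed
  then show ?thesis
    by (simp add: weak_laplacian_def laplacian_pairing_def face_pairing_def sum_subtractf algebra_simps)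
qed

lemma laplacian_pairing_lincomb:
  assumes M: "is_mesh \<Omega> M" "T \<in> cells M" and v: "v \<in> Vh M k"
    and \<phi>: "\<phi> \<in> poly_space r" and \<psi>: "\<psi> \<in> poly_space r"
  shows "laplacian_pairing M v T (\<lambda>x. c * \<phi> x + \<psi> x)
    = c * laplacian_pairing M v T \<phi> + laplacian_pairing M v T \<psi>"
proof -
  have "L2_ip (lebesgue_on T) (v0 v T) (laplacian (\<lambda>x. c * \<phi> x + \<psi> x)) =
      c * L2_ip (lebesgue_on T) (v0 v T) (laplacian \<phi>) + L2_ip (lebesgue_on T) (v0 v T) (laplacian \<psi>)"
    unfolding laplacian_lincomb[OF \<phi> \<psi>]
    using poly_space_L2_cell[OF M] laplacian_poly_space[OF \<phi>] laplacian_poly_space[OF \<psi>] VhD(1)[OF v M(2)]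
    by (intro L2_ip_lincomb(2)) auto
  moreover have "face_pairing M v T (\<lambda>x. c * \<phi> x + \<psi> x) = c * face_pairing M v T \<phi> + face_pairing M v T \<psi>"
  proof -
    have 1: "L2_ip (fmeas M e) (vn v e) (\<lambda>x. c * \<phi> x + \<psi> x)
        = c * L2_ip (fmeas M e) (vn v e) \<phi> + L2_ip (fmeas M e) (vn v e) \<psi>" if "e \<in> cell_faces M T" for e
      using poly_space_L2_face[OF M(1) cell_faces_subset[OF that]] \<phi> \<psi>
        Vh_L2(3)[OF M(1) v cell_faces_subset[OF that]]
      by (intro L2_ip_lincomb(2)) auto
    have 2: "L2_ip (fmeas M e) (vb v e) (\<lambda>x. grad (\<lambda>x. c * \<phi> x + \<psi> x) x \<bullet> n)
        = c * L2_ip (fmeas M e) (vb v e) (\<lambda>x. grad \<phi> x \<bullet> n) + L2_ip (fmeas M e) (vb v e) (\<lambda>x. grad \<psi> x \<bullet> n)"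
      if "e \<in> cell_faces M T" for e n
      unfolding grad_inner_lincomb[OF \<phi> \<psi>]
      using poly_space_L2_face[OF M(1) cell_faces_subset[OF that]]
        grad_inner_poly_space[OF \<phi>] grad_inner_poly_space[OF \<psi>]
        Vh_L2(2)[OF M(1) v cell_faces_subset[OF that]]
      by (intro L2_ip_lincomb(2)) auto
    show ?thesis
      unfolding face_pairing_def sum_distrib_left sum.distrib[symmetric]
      by (intro sum.cong refl) (simp add: 1 2 right_diff_distrib distrib_left mult.left_commute)
  qed
  ultimately show ?thesis by (simp add: laplacian_pairing_def algebra_simps)
qed

text \<open>The pairing is linear in the test polynomial, so the Riesz theorem gives existence and uniqueness.\<close>

lemma weak_laplacian_char:
  assumes M: "is_mesh \<Omega> M" "T \<in> cells M" and v: "v \<in> Vh M k"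
  shows "weak_laplacian M r v T \<in> poly_space r"
    and "\<And>\<phi>. \<phi> \<in> poly_space r \<Longrightarrow>
      L2_ip (lebesgue_on T) (weak_laplacian M r v T) \<phi> = laplacian_pairing M v T \<phi>"
proof -
  obtain B where B: "orthonormal_basis (lebesgue_on T) (poly_space r) B"
    using poly_space_orthonormal_basis[OF M] by blast
  have "\<exists>!w. w \<in> poly_space r \<and> (\<forall>\<phi>\<in>poly_space r. L2_ip (lebesgue_on T) w \<phi> = laplacian_pairing M v T \<phi>)"
    by (rule orthonormal_basis_Riesz[OF B function_subspace_poly_space poly_space_L2_cell[OF M]
        laplacian_pairing_lincomb[OF M v]])
  from theI'[OF this, folded weak_laplacian_eq]
  show "weak_laplacian M r v T \<in> poly_space r"
    and "\<And>\<phi>. \<phi> \<in> poly_space r \<Longrightarrow>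
      L2_ip (lebesgue_on T) (weak_laplacian M r v T) \<phi> = laplacian_pairing M v T \<phi>" by blast+
qed

text \<open>Taking the weak Laplacian of the second argument as test polynomial in the characterisation of the
  weak Laplacian of the first one removes the definite description of the first argument. Linearity
  and boundedness of the form in that argument are then those of the pairing.\<close>

lemma wg_form_pairing:
  assumes M: "is_mesh \<Omega> M" and u: "u \<in> Vh M k" and v: "v \<in> Vh M k"
  shows "wg_form M r u v = (\<Sum>T\<in>cells M. laplacian_pairing M u T (weak_laplacian M r v T))"
  unfolding wg_form_def
  using weak_laplacian_char[OF M _ u] weak_laplacian_char[OF M _ v] by (intro sum.cong) auto

lemma wg_form_commute: "wg_form M r u v = wg_form M r v u"
  by (simp add: wg_form_def L2_ip_commute)

lemma wg_form_self_nonneg: "0 \<le> wg_form M r v v"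
  by (simp add: wg_form_def sum_nonneg)

lemma Vh_functional_wg_form:
  assumes M: "is_mesh \<Omega> M" and v: "v \<in> Vh M k"
  shows "Vh_functional M k (\<lambda>u. wg_form M r u v)"
proof -
  have "Vh_functional M k (\<lambda>u. laplacian_pairing M u T \<phi>)"
    if T: "T \<in> cells M" and \<phi>: "\<phi> \<in> poly_space r" for T \<phi>
  proof -
    have cell: "Vh_functional M k (\<lambda>u. L2_ip (lebesgue_on T) (v0 u T) (laplacian \<phi>))"
      using laplacian_poly_space[OF \<phi>] poly_space_L2_cell[OF M T]
      by (intro Vh_functional_components(1)[OF M T]) auto
    have "Vh_functional M k (\<lambda>u. (nrm M e \<bullet> outward_normal T e) * L2_ip (fmeas M e) (vn u e) \<phi>
        + (-1) * L2_ip (fmeas M e) (vb u e) (\<lambda>x. grad \<phi> x \<bullet> outward_normal T e))"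
      if "e \<in> cell_faces M T" for e
      using poly_space_L2_face[OF M cell_faces_subset[OF that]] \<phi> grad_inner_poly_space[OF \<phi>]
      by (intro Vh_functional_add Vh_functional_scale
          Vh_functional_components(2,3)[OF M cell_faces_subset[OF that]]) auto
    then have "Vh_functional M k (\<lambda>u. \<Sum>e\<in>cell_faces M T.
        (nrm M e \<bullet> outward_normal T e) * L2_ip (fmeas M e) (vn u e) \<phi>
        + (-1) * L2_ip (fmeas M e) (vb u e) (\<lambda>x. grad \<phi> x \<bullet> outward_normal T e))"
      by (intro Vh_functional_sum)
    from Vh_functional_add[OF cell this]
    show ?thesis by (simp add: laplacian_pairing_def face_pairing_def)
  qed
  then have F: "Vh_functional M k (\<lambda>u. \<Sum>T\<in>cells M. laplacian_pairing M u T (weak_laplacian M r v T))"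
    using weak_laplacian_char(1)[OF M _ v] by (intro Vh_functional_sum) auto
  show ?thesis
    using F wg_form_pairing[OF M Vh_diff v] wg_form_pairing[OF M _ v]
    unfolding Vh_functional_def by simp
qed

text \<open>The test functions of the energy argument: a polynomial on a single cell, and a discrete function
  stripped of its interior component. By \<open>wg_form_split\<close> they suffice to recover the form at an
  arbitrary second argument.\<close>

definition cell_function :: "'a set \<Rightarrow> ('a \<Rightarrow> real) \<Rightarrow> 'a wg" where
  "cell_function T q = ((\<lambda>S. if S = T then q else (\<lambda>x. 0)), (\<lambda>e x. 0), (\<lambda>e x. 0))"

definition face_component :: "'a wg \<Rightarrow> 'a wg" where
  "face_component v = ((\<lambda>T x. 0), vb v, vn v)"

lemma cell_function_simps [simp]:
  "v0 (cell_function T q) S = (if S = T then q else (\<lambda>x. 0))"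
  "vb (cell_function T q) e = (\<lambda>x. 0)" "vn (cell_function T q) e = (\<lambda>x. 0)"
  by (simp_all add: cell_function_def v0_def vb_def vn_def)

lemma face_component_simps [simp]:
  "v0 (face_component v) T = (\<lambda>x. 0)"
  "vb (face_component v) = vb v" "vn (face_component v) = vn v"
  by (simp_all add: face_component_def v0_def vb_def vn_def)

lemma cell_function_Vh0:
  assumes "T \<in> cells M" "q \<in> poly_space k"
  shows "cell_function T q \<in> Vh0 \<Omega> M k"
proof -
  have "cell_function T q \<in> Vh M k"
    using assms by (intro VhI) (auto intro: P_face_zero poly_space_zero)
  then show ?thesis by (simp add: Vh0_def zero_fun_def)
qed

lemma face_component_Vh0:
  assumes "v \<in> Vh0 \<Omega> M k"
  shows "face_component v \<in> Vh0 \<Omega> M k"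
proof -
  have "face_component v \<in> Vh M k"
    using VhD[OF Vh0_subset[OF assms]] by (intro VhI) (auto intro: poly_space_zero)
  then show ?thesis using assms by (simp add: Vh0_def)
qed

lemma wg_form_cell_function:
  assumes M: "is_mesh \<Omega> M" "T \<in> cells M" and u: "u \<in> Vh M k" and q: "q \<in> poly_space k"
  shows "wg_form M r u (cell_function T q) = L2_ip (lebesgue_on T) q (laplacian (weak_laplacian M r u T))"
proof -
  have "cell_function T q \<in> Vh M k" using Vh0_subset cell_function_Vh0[OF M(2) q] by blast
  then have "wg_form M r u (cell_function T q)
      = (\<Sum>S\<in>cells M. laplacian_pairing M (cell_function T q) S (weak_laplacian M r u S))"
    using wg_form_pairing[OF M(1) _ u] by (subst wg_form_commute) blast
  also have "\<dots> = (\<Sum>S\<in>cells M. if S = T then L2_ip (lebesgue_on T) q (laplacian (weak_laplacian M r u T)) else 0)"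
    by (intro sum.cong) (auto simp: laplacian_pairing_def face_pairing_def)
  also have "\<dots> = L2_ip (lebesgue_on T) q (laplacian (weak_laplacian M r u T))"
    using M(2) is_meshD(1)[OF M(1)] by simp
  finally show ?thesis .
qed

lemma wg_form_split:
  assumes M: "is_mesh \<Omega> M" and u: "u \<in> Vh M k" and v: "v \<in> Vh0 \<Omega> M k"
    and B: "\<And>T. T \<in> cells M \<Longrightarrow> orthonormal_basis (lebesgue_on T) (poly_space k) (B T)"
  shows "wg_form M r u v =
    (\<Sum>T\<in>cells M. \<Sum>b\<in>B T. L2_ip (lebesgue_on T) (v0 v T) b * wg_form M r u (cell_function T b))
      + wg_form M r u (face_component v)"
proof -
  note vV = Vh0_subset[OF v] and fV = Vh0_subset[OF face_component_Vh0[OF v]]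
  have cell: "L2_ip (lebesgue_on T) (v0 v T) (laplacian (weak_laplacian M r u T))
      = (\<Sum>b\<in>B T. L2_ip (lebesgue_on T) (v0 v T) b * wg_form M r u (cell_function T b))"
    if T: "T \<in> cells M" for T
  proof -
    note BT = orthonormal_basisD[OF B[OF T]]
    let ?g = "laplacian (weak_laplacian M r u T)"
    have g: "?g \<in> L2 (lebesgue_on T)"
      using weak_laplacian_char(1)[OF M T u] laplacian_poly_space poly_space_L2_cell[OF M T] by blast
    have "L2_ip (lebesgue_on T) (v0 v T) ?g
        = L2_ip (lebesgue_on T) (\<lambda>x. \<Sum>b\<in>B T. L2_ip (lebesgue_on T) (v0 v T) b * b x) ?g"
      by (rule arg_cong[OF BT(4)[OF VhD(1)[OF vV T]]])
    also have "\<dots> = (\<Sum>b\<in>B T. L2_ip (lebesgue_on T) (v0 v T) b * L2_ip (lebesgue_on T) b ?g)"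
      using BT(2) poly_space_L2_cell[OF M T] g by (intro L2_ip_sum) auto
    also have "\<dots> = (\<Sum>b\<in>B T. L2_ip (lebesgue_on T) (v0 v T) b * wg_form M r u (cell_function T b))"
    proof (intro sum.cong refl)
      fix b assume "b \<in> B T"
      then have "b \<in> poly_space k" using BT(2) by blast
      from wg_form_cell_function[OF M T u this]
      show "L2_ip (lebesgue_on T) (v0 v T) b * L2_ip (lebesgue_on T) b ?g
          = L2_ip (lebesgue_on T) (v0 v T) b * wg_form M r u (cell_function T b)" by simp
    qed
    finally show ?thesis .
  qed
  have "wg_form M r u v = (\<Sum>T\<in>cells M. laplacian_pairing M v T (weak_laplacian M r u T))"
    using wg_form_pairing[OF M vV u] by (simp add: wg_form_commute)
  also have "\<dots> = (\<Sum>T\<in>cells M. L2_ip (lebesgue_on T) (v0 v T) (laplacian (weak_laplacian M r u T)))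
      + (\<Sum>T\<in>cells M. laplacian_pairing M (face_component v) T (weak_laplacian M r u T))"
    by (simp add: laplacian_pairing_def face_pairing_def sum.distrib)
  also have "(\<Sum>T\<in>cells M. laplacian_pairing M (face_component v) T (weak_laplacian M r u T))
      = wg_form M r u (face_component v)"
    using wg_form_pairing[OF M fV u] by (simp add: wg_form_commute)
  finally show ?thesis using cell by simp
qed

text \<open>Every term of \<open>norm_2h\<close> is a nonnegative multiple of a square, so all of them vanish. With
  \<open>v\<^sub>0 = 0\<close> the face terms are the norms of \<open>v\<^sub>b\<close> and, since \<open>n\<^sub>e\<close> is plus or minus the outward normal,
  of \<open>v\<^sub>n\<close>.\<close>

lemma norm_2h_definite:
  fixes M :: "(real^'n::finite) mesh"
  assumes M: "is_mesh \<Omega> M" and v: "v \<in> Vh M k" and v0: "\<And>T. T \<in> cells M \<Longrightarrow> v0 v T = (\<lambda>x. 0)"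
    and zero: "norm_2h M v = 0" and e: "e \<in> faces M"
  shows "vb v e = (\<lambda>x. 0)" "vn v e = (\<lambda>x. 0)"
proof -
  obtain T where T: "T \<in> cells M" "e \<in> cell_faces M T" using is_meshD(8)[OF M e] by blast
  define A where "A T = (L2_norm (lebesgue_on T) (laplacian (v0 v T)))\<^sup>2" for T
  define Bb where "Bb T e = (L2_norm (fmeas M e) (\<lambda>x. v0 v T x - vb v e x))\<^sup>2" for T e
  define Bn where "Bn T e = (L2_norm (fmeas M e)
    (\<lambda>x. (grad (v0 v T) x - vn v e x *\<^sub>R nrm M e) \<bullet> outward_normal T e))\<^sup>2" for T e
  note defs = A_def Bb_def Bn_def
  let ?S = "\<lambda>T. A T + (\<Sum>e\<in>cell_faces M T. Bb T e) / diameter T ^ 3 + (\<Sum>e\<in>cell_faces M T. Bn T e) / diameter T"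
  have nn: "0 \<le> A T" "0 \<le> (\<Sum>e\<in>cell_faces M T. Bb T e)" "0 \<le> (\<Sum>e\<in>cell_faces M T. Bn T e)" for T
    by (auto simp: defs intro: sum_nonneg)
  have d: "diameter T > 0" if "T \<in> cells M" for T by (rule cells_diameter_pos[OF M that])
  have "(\<Sum>T\<in>cells M. ?S T) = 0" using zero by (simp add: norm_2h_def defs)
  moreover have "0 \<le> ?S T" if "T \<in> cells M" for T
    using nn[of T] d[OF that] by (simp add: add_nonneg_nonneg)
  ultimately have "?S T = 0"
    using sum_nonneg_eq_0_iff[OF is_meshD(1)[OF M], of ?S] T(1) by blast
  moreover have "0 \<le> (\<Sum>e\<in>cell_faces M T. Bb T e) / diameter T ^ 3"
      "0 \<le> (\<Sum>e\<in>cell_faces M T. Bn T e) / diameter T"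
    using nn[of T] d[OF T(1)] by simp_all
  ultimately have "(\<Sum>e\<in>cell_faces M T. Bb T e) / diameter T ^ 3 = 0"
      "(\<Sum>e\<in>cell_faces M T. Bn T e) / diameter T = 0"
    using nn(1)[of T] by linarith+
  then have "(\<Sum>e\<in>cell_faces M T. Bb T e) = 0" "(\<Sum>e\<in>cell_faces M T. Bn T e) = 0"
    using d[OF T(1)] by simp_all
  then have "Bb T e = 0" "Bn T e = 0"
    using sum_nonneg_eq_0_iff[OF finite_cell_faces[OF M], of T "Bb T"]
      sum_nonneg_eq_0_iff[OF finite_cell_faces[OF M], of T "Bn T"] T(2) by (auto simp: defs)
  moreover have "grad (\<lambda>x::real^'n. 0) = (\<lambda>x. 0)" by (simp add: grad_def fun_eq_iff vec_eq_iff)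
  ultimately have b: "L2_norm (fmeas M e) (\<lambda>x. - vb v e x) = 0"
    and n: "L2_norm (fmeas M e) (\<lambda>x. - ((vn v e x *\<^sub>R nrm M e) \<bullet> outward_normal T e)) = 0"
    using v0[OF T(1)] by (simp_all add: defs)
  have "L2_norm (fmeas M e) (vb v e) = 0" using b by (simp add: L2_norm_def)
  then show "vb v e = (\<lambda>x. 0)" by (rule P_face_definite[OF M e VhD(2)[OF v e]])
  have "L2_norm (fmeas M e) (vn v e) = 0"
    using n outward_normal_inner_nrm[OF M T] by (simp add: L2_norm_def power_mult_distrib)
  then show "vn v e = (\<lambda>x. 0)" by (rule P_face_definite[OF M e VhD(3)[OF v e]])
qed

section \<open>Weak and classical derivatives in time\<close>

lemma borel_measurable_lebesgue_on_AE:
  fixes f g :: "'a::euclidean_space \<Rightarrow> real"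
  assumes "S \<in> sets lebesgue" "f \<in> borel_measurable (lebesgue_on S)" "AE x in lebesgue_on S. f x = g x"
  shows "g \<in> borel_measurable (lebesgue_on S)"
proof -
  have "(\<lambda>x. if x \<in> S then f x else 0) \<in> borel_measurable lebesgue"
    using assms by (simp add: borel_measurable_if)
  moreover have "AE x in lebesgue. (if x \<in> S then f x else 0) = (if x \<in> S then g x else 0)"
  proof -
    have "AE x in lebesgue. x \<in> S \<longrightarrow> f x = g x"
      using assms(1,3) by (simp add: AE_restrict_space_iff)
    then show ?thesis by (rule eventually_mono) auto
  qed
  ultimately have "(\<lambda>x. if x \<in> S then g x else 0) \<in> borel_measurable lebesgue"
    by (rule borel_measurable_AE)
  then show ?thesis using assms(1) by (simp add: borel_measurable_if)
qed

lemma continuous_AE_zero_imp_zero: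
  fixes g :: "real \<Rightarrow> real"
  assumes \<tau>: "\<tau> > 0" and g: "continuous_on {0..\<tau>} g"
    and ae: "AE t in lebesgue_on {0<..<\<tau>}. g t = 0" and t: "t \<in> {0..\<tau>}"
  shows "g t = 0"
proof (rule continuous_constant_on_closure[where S = "{0<..<\<tau>}" and f = g])
  show "continuous_on (closure {0<..<\<tau>}) g" "t \<in> closure {0<..<\<tau>}" using g t \<tau> by simp_all
  show "g s = 0" if "s \<in> {0<..<\<tau>}" for s
  proof -
    have cont: "continuous_on (interior {0<..<\<tau>}) g"
      using g by (rule continuous_on_subset) auto
    have s: "s \<in> interior {0<..<\<tau>}" using that by simp
    have S: "{0<..<\<tau>} \<in> sets lebesgue" by simp
    show ?thesis
      by (rule AE_zero_continuous_imp_zero[OF ae cont lebesgue_on_charges_interior[OF S] s])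
  qed
qed

lemma continuous_antiderivative:
  fixes f :: "real \<Rightarrow> real"
  assumes "continuous_on UNIV f"
  shows "\<exists>F. \<forall>x. (F has_real_derivative f x) (at x)"
proof -
  have "\<exists>F. \<forall>x::real. (-\<infinity>::ereal) < x \<longrightarrow> x < (\<infinity>::ereal) \<longrightarrow> (F has_vector_derivative f x) (at x)"
    using assms by (intro einterval_antiderivative) (auto simp: continuous_on_eq_continuous_at)
  then show ?thesis by (simp add: has_real_derivative_iff_has_vector_derivative)
qed

lemma integral_derivative:
  fixes F :: "real \<Rightarrow> real"
  assumes "a \<le> b" "\<And>t. (F has_real_derivative f t) (at t)"
  shows "(f has_integral (F b - F a)) {a..b}"
  using assms
  by (intro fundamental_theorem_of_calculus)
     (auto simp: has_real_derivative_iff_has_vector_derivative[symmetric] intro: has_field_derivative_at_within)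

lemma LINT_support_interval:
  fixes f :: "real \<Rightarrow> real"
  assumes "0 < a" "b < \<tau>" "continuous_on {a..b} f" "\<And>t. t \<notin> {a..b} \<Longrightarrow> f t = 0"
  shows "(LINT t|lebesgue_on {0<..<\<tau>}. f t) = integral {a..b} f"
proof -
  have "(LINT t|lebesgue_on {0<..<\<tau>}. f t) = (LINT t|lebesgue. indicator {0<..<\<tau>} t *\<^sub>R f t)"
    by (rule integral_restrict_space) simp
  also have "\<dots> = (LINT t|lebesgue. indicator {a..b} t *\<^sub>R f t)"
    using assms(1,2,4) by (intro Bochner_Integration.integral_cong) (auto simp: indicator_def)
  also have "\<dots> = (LINT t|lebesgue_on {a..b}. f t)"
    by (rule integral_restrict_space[symmetric]) simp
  also have "\<dots> = integral {a..b} f"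
    by (intro lebesgue_integral_eq_integral continuous_imp_integrable_real assms) simp
  finally show ?thesis .
qed

text \<open>A continuous function \<open>h\<close> with continuous weak derivative \<open>g\<close> is classically differentiable. If \<open>G\<close> is
  an antiderivative of \<open>g\<close> and \<open>H = h - G\<close>, then \<open>H\<close> integrates to zero against the derivative of every
  test function, that is, against every continuous function supported in \<open>[a, b]\<close> with mean zero.
  One of these is \<open>(H - m) \<eta>\<close>, where \<open>\<eta>\<close> is a hat function and \<open>m\<close> the mean of \<open>H\<close> with weight \<open>\<eta>\<close>, and it
  gives \<open>\<integral> (H - m)\<^sup>2 \<eta> = 0\<close>. So \<open>H\<close> is constant near \<open>s\<close>.\<close>

lemma du_Bois_Reymond:
  fixes h g :: "real \<Rightarrow> real"
  assumes h: "continuous_on {0..\<tau>} h" and g: "continuous_on {0..\<tau>} g"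
    and weak: "\<And>\<phi> \<phi>'. (\<forall>t. (\<phi> has_real_derivative \<phi>' t) (at t)) \<Longrightarrow> continuous_on UNIV \<phi>' \<Longrightarrow>
        \<exists>a b. 0 < a \<and> b < \<tau> \<and> (\<forall>t. t \<notin> {a..b} \<longrightarrow> \<phi> t = 0) \<Longrightarrow>
        (LINT t|lebesgue_on {0<..<\<tau>}. h t * \<phi>' t) = - (LINT t|lebesgue_on {0<..<\<tau>}. g t * \<phi> t)"
    and s: "0 < s" "s < \<tau>"
  shows "(h has_real_derivative g s) (at s)"
proof -
  define a b where "a = s / 2" and "b = (s + \<tau>) / 2"
  have ab: "0 < a" "a < s" "s < b" "b < \<tau>" "a \<le> b" "a < b" using s by (auto simp: a_def b_def)
  \<comment> \<open>Composition with \<open>c\<close> extends functions continuously from \<open>[a, b]\<close> to the line, where test functions live.\<close>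
  define c where "c t = max a (min b t)" for t
  have c_range: "c t \<in> {0..\<tau>}" for t using ab by (auto simp: c_def)
  have c_id: "c t = t" if "t \<in> {a..b}" for t using that by (auto simp: c_def)
  have c_cont: "continuous_on S c" for S unfolding c_def[abs_def] by (intro continuous_intros)
  have gc: "continuous_on UNIV (\<lambda>t. g (c t))" and hc: "continuous_on UNIV (\<lambda>t. h (c t))"
    using c_range by (auto intro!: continuous_on_compose2[OF g c_cont] continuous_on_compose2[OF h c_cont])
  obtain G where G: "\<And>t. (G has_real_derivative g (c t)) (at t)"
    using continuous_antiderivative[OF gc] by blast
  have G_cont: "continuous_on S G" for S
    by (meson G DERIV_isCont continuous_at_imp_continuous_on)
  define H where "H t = h (c t) - G t" for t
  have H_cont: "continuous_on S H" for S
    unfolding H_def[abs_def] by (intro continuous_intros G_cont continuous_on_subset[OF hc]) auto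
  define \<eta> where "\<eta> t = max 0 (min (t - a) (b - t))" for t
  have \<eta>_cont: "continuous_on S \<eta>" for S unfolding \<eta>_def[abs_def] by (intro continuous_intros)
  have \<eta>_off: "\<eta> t = 0" if "t \<notin> {a<..<b}" for t using that by (auto simp: \<eta>_def)
  have \<eta>_pos: "\<eta> t > 0" if "t \<in> {a<..<b}" for t using that by (auto simp: \<eta>_def)
  have \<eta>_nonneg: "\<eta> t \<ge> 0" for t by (simp add: \<eta>_def)
  have \<eta>_int: "integral {a..b} \<eta> \<noteq> 0"
    using integral_eq_0_iff[OF \<eta>_cont \<open>a < b\<close> \<eta>_nonneg] \<eta>_pos[of s] ab by force
  define m where "m = integral {a..b} (\<lambda>t. H t * \<eta> t) / integral {a..b} \<eta>"
  define \<phi>' where "\<phi>' t = (H t - m) * \<eta> t" for t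
  have \<phi>'_cont: "continuous_on S \<phi>'" for S
    unfolding \<phi>'_def[abs_def] by (intro continuous_intros H_cont \<eta>_cont)
  have \<phi>'_off: "\<phi>' t = 0" if "t \<notin> {a<..<b}" for t using \<eta>_off[OF that] by (simp add: \<phi>'_def)
  have int: "f integrable_on {a..b}" if "continuous_on {a..b} f" for f :: "real \<Rightarrow> real"
    using that by (rule integrable_continuous_real)
  have \<phi>'_mean: "integral {a..b} \<phi>' = 0"
  proof -
    have "\<phi>' = (\<lambda>t. H t * \<eta> t - m * \<eta> t)" by (auto simp: \<phi>'_def algebra_simps)
    then have "integral {a..b} \<phi>' = integral {a..b} (\<lambda>t. H t * \<eta> t) - m * integral {a..b} \<eta>"
      by (simp add: integral_diff int H_cont \<eta>_cont continuous_intros)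
    then show ?thesis using \<eta>_int by (simp add: m_def)
  qed
  obtain \<Phi> where \<Phi>: "\<And>t. (\<Phi> has_real_derivative \<phi>' t) (at t)"
    using continuous_antiderivative[OF \<phi>'_cont] by blast
  define \<phi> where "\<phi> t = \<Phi> t - \<Phi> a" for t
  have \<phi>: "(\<phi> has_real_derivative \<phi>' t) (at t)" for t
    unfolding \<phi>_def[abs_def] by (auto intro!: derivative_eq_intros \<Phi>)
  have \<phi>_cont: "continuous_on S \<phi>" for S
    by (meson \<phi> DERIV_isCont continuous_at_imp_continuous_on)
  have zero_int: "\<phi> y = \<phi> x" if "x \<le> y" "\<And>t. t \<in> {x..y} \<Longrightarrow> \<phi>' t = 0" for x y
  proof -
    have "(\<phi>' has_integral 0) {x..y}" by (rule has_integral_is_0) (use that in auto)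
    then show ?thesis using has_integral_unique[OF integral_derivative[OF that(1) \<phi>]] by fastforce
  qed
  have \<phi>a: "\<phi> a = 0" by (simp add: \<phi>_def)
  have \<phi>b: "\<phi> b = 0"
    using integral_unique[OF integral_derivative[OF \<open>a \<le> b\<close> \<phi>]] \<phi>'_mean \<phi>a by simp
  have \<phi>_off: "\<phi> t = 0" if "t \<notin> {a..b}" for t
  proof (cases "t < a")
    case True
    then show ?thesis using zero_int[of t a] \<phi>'_off \<phi>a by auto
  next
    case False
    then show ?thesis using that zero_int[of b t] \<phi>'_off \<phi>b by auto
  qed
  have h_ab: "continuous_on {a..b} h" and g_ab: "continuous_on {a..b} g"
    using ab by (auto intro: continuous_on_subset[OF h] continuous_on_subset[OF g])
  have "(LINT t|lebesgue_on {0<..<\<tau>}. h t * \<phi>' t) = - (LINT t|lebesgue_on {0<..<\<tau>}. g t * \<phi> t)"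
    using \<phi> \<phi>'_cont \<phi>_off ab by (intro weak) blast+
  then have 1: "integral {a..b} (\<lambda>t. h t * \<phi>' t) = - integral {a..b} (\<lambda>t. g t * \<phi> t)"
    using ab \<phi>'_off \<phi>_off
    by (subst (asm) (1 2) LINT_support_interval[of a b])
       (auto intro!: continuous_intros h_ab g_ab \<phi>_cont \<phi>'_cont)
  have "((\<lambda>t. G t * \<phi> t) has_real_derivative g (c t) * \<phi> t + G t * \<phi>' t) (at t)" for t
    by (auto intro!: derivative_eq_intros G \<phi>)
  from integral_unique[OF integral_derivative[OF \<open>a \<le> b\<close> this]]
  have "integral {a..b} (\<lambda>t. g (c t) * \<phi> t + G t * \<phi>' t) = 0" by (simp add: \<phi>a \<phi>b)
  moreover have "integral {a..b} (\<lambda>t. g (c t) * \<phi> t + G t * \<phi>' t)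
      = integral {a..b} (\<lambda>t. g t * \<phi> t + G t * \<phi>' t)"
    by (intro integral_cong) (simp add: c_id)
  ultimately have 2: "integral {a..b} (\<lambda>t. g t * \<phi> t) + integral {a..b} (\<lambda>t. G t * \<phi>' t) = 0"
    by (subst integral_add[symmetric])
       (auto intro!: int continuous_intros g_ab \<phi>_cont G_cont \<phi>'_cont)
  have "integral {a..b} (\<lambda>t. (H t - m)\<^sup>2 * \<eta> t)
      = integral {a..b} (\<lambda>t. (h t * \<phi>' t - G t * \<phi>' t) - m * \<phi>' t)"
    by (intro integral_cong) (simp add: H_def c_id \<phi>'_def power2_eq_square algebra_simps)
  also have "\<dots> = integral {a..b} (\<lambda>t. h t * \<phi>' t) - integral {a..b} (\<lambda>t. G t * \<phi>' t) - m * integral {a..b} \<phi>'"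
    by (simp add: integral_diff int continuous_intros h_ab G_cont \<phi>'_cont)
  also have "\<dots> = 0" using 1 2 \<phi>'_mean by simp
  finally have int0: "integral {a..b} (\<lambda>t. (H t - m)\<^sup>2 * \<eta> t) = 0" .
  have cont: "continuous_on {a..b} (\<lambda>t. (H t - m)\<^sup>2 * \<eta> t)"
    by (intro continuous_intros H_cont \<eta>_cont)
  have zero: "(H t - m)\<^sup>2 * \<eta> t = 0" if "t \<in> {a..b}" for t
    using integral_eq_0_iff[OF cont \<open>a < b\<close>] int0 that \<eta>_nonneg by simp
  have eq: "G t + m = h t" if "t \<in> {a<..<b}" for t
    using zero[of t] \<eta>_pos[OF that] that by (simp add: H_def c_id)
  have "((\<lambda>t. G t + m) has_real_derivative g s) (at s)"
    using G[of s] c_id[of s] ab by (auto intro!: derivative_eq_intros)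
  then show ?thesis
    by (rule has_field_derivative_transform_within_open[where S = "{a<..<b}"]) (use ab in \<open>auto simp: eq\<close>)
qed

text \<open>Measurability comes from the approximating simple functions: their images under \<open>L\<close> converge almost
  everywhere, and Lebesgue measure is complete. Since \<open>N \<le> 1 + N\<^sup>2\<close>, square integrability of the norm
  bounds the integral.\<close>

lemma Vh_functional_bochner_integrable:
  assumes L: "Vh_functional M k L" and w: "bochner_L2 \<tau> (Vh0 \<Omega> M k) (wg_norm M) w"
    and \<phi>: "continuous_on {0..\<tau>} \<phi>"
  shows "integrable (lebesgue_on {0<..<\<tau>}) (\<lambda>t. L (w t) * \<phi> t)"
proof -
  let ?m = "lebesgue_on {0<..<\<tau>}"
  obtain C where C: "\<And>v. v \<in> Vh M k \<Longrightarrow> \<bar>L v\<bar> \<le> C * wg_norm M v"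
    using L unfolding Vh_functional_def by blast
  obtain s where wX: "AE t in ?m. w t \<in> Vh0 \<Omega> M k"
    and s: "\<And>i. simple_function ?m (s i)" "\<And>i t. t \<in> {0<..<\<tau>} \<Longrightarrow> s i t \<in> Vh0 \<Omega> M k"
    and lim: "AE t in ?m. (\<lambda>i. wg_norm M (s i t - w t)) \<longlonglongrightarrow> 0"
    and int: "integrable ?m (\<lambda>t. (wg_norm M (w t))\<^sup>2)"
    using w unfolding bochner_L2_def by blast
  have meas_s: "(\<lambda>t. L (s i t)) \<in> borel_measurable ?m" for i
    by (rule borel_measurable_simple_function) (rule simple_function_compose1[OF s(1)])
  have space: "AE t in ?m. t \<in> {0<..<\<tau>}" by (rule AE_I2) (simp add: space_restrict_space)
  have "AE t in ?m. lim (\<lambda>i. L (s i t)) = L (w t)"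
    using wX lim space
  proof eventually_elim
    case (elim t)
    have "\<bar>L (s i t) - L (w t)\<bar> \<le> C * wg_norm M (s i t - w t)" for i
      using C[OF Vh_diff] Vh_functional_diff[OF L] s(2)[OF elim(3)] elim(1) Vh0_subset by metis
    then have "eventually (\<lambda>i. norm (L (s i t) - L (w t)) \<le> C * wg_norm M (s i t - w t)) sequentially"
      by simp
    moreover have "(\<lambda>i. C * wg_norm M (s i t - w t)) \<longlonglongrightarrow> 0"
      using tendsto_mult_left[OF elim(2), of C] by simp
    ultimately have "(\<lambda>i. L (s i t) - L (w t)) \<longlonglongrightarrow> 0"
      by (rule Lim_null_comparison)
    then have "(\<lambda>i. L (s i t)) \<longlonglongrightarrow> L (w t)" by (simp add: LIM_zero_iff)
    then show ?case by (rule limI)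
  qed
  then have meas: "(\<lambda>t. L (w t)) \<in> borel_measurable ?m"
    by (intro borel_measurable_lebesgue_on_AE[OF _ borel_measurable_lim_metric[OF meas_s]]) auto
  have "compact (\<phi> ` {0..\<tau>})" by (intro compact_continuous_image \<phi> compact_Icc)
  then obtain K where K: "\<And>t. t \<in> {0..\<tau>} \<Longrightarrow> \<bar>\<phi> t\<bar> \<le> K"
    using compact_imp_bounded bounded_iff by (metis image_eqI real_norm_def)
  have meas_\<phi>: "\<phi> \<in> borel_measurable ?m"
    by (intro continuous_imp_measurable_on_sets_lebesgue continuous_on_subset[OF \<phi>]) auto
  have fin: "integrable ?m (\<lambda>t. 1 :: real)"
    by (intro finite_measure.integrable_const finite_measure_lebesgue_on) simp
  show ?thesis
  proof (rule Bochner_Integration.integrable_bound)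
    show "integrable ?m (\<lambda>t. \<bar>C\<bar> * \<bar>K\<bar> * (1 + (wg_norm M (w t))\<^sup>2))"
      using int fin by (intro integrable_mult_right Bochner_Integration.integrable_add)
    show "(\<lambda>t. L (w t) * \<phi> t) \<in> borel_measurable ?m" using meas meas_\<phi> by (rule borel_measurable_times)
    show "AE t in ?m. norm (L (w t) * \<phi> t) \<le> norm (\<bar>C\<bar> * \<bar>K\<bar> * (1 + (wg_norm M (w t))\<^sup>2))"
      using wX space
    proof eventually_elim
      case (elim t)
      let ?n = "wg_norm M (w t)"
      have n0: "0 \<le> ?n" unfolding wg_norm_def by (intro real_sqrt_ge_zero add_nonneg_nonneg sum_nonneg) auto
      have "0 \<le> (?n - 1)\<^sup>2" by simp
      then have n: "?n \<le> 1 + ?n\<^sup>2" using n0 by (simp add: power2_diff)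
      have "\<bar>L (w t)\<bar> \<le> C * ?n" using C elim(1) Vh0_subset by blast
      also have "\<dots> \<le> \<bar>C\<bar> * ?n" using n0 by (intro mult_right_mono) auto
      also have "\<dots> \<le> \<bar>C\<bar> * (1 + ?n\<^sup>2)" using n by (intro mult_left_mono) auto
      finally have "\<bar>L (w t)\<bar> * \<bar>\<phi> t\<bar> \<le> (\<bar>C\<bar> * (1 + ?n\<^sup>2)) * \<bar>K\<bar>"
        using K[of t] elim(2) by (intro mult_mono) auto
      then show ?case by (simp add: abs_mult mult_ac)
    qed
  qed
qed

lemma H1_timeD:
  assumes "H1_time \<tau> \<Omega> M k u w"
  shows "bochner_L2 \<tau> (Vh0 \<Omega> M k) (wg_norm M) u" "bochner_L2 \<tau> (Vh0 \<Omega> M k) (wg_norm M) w"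
    "weak_time_deriv \<tau> u w" "\<And>t. t \<in> {0..\<tau>} \<Longrightarrow> u t \<in> Vh0 \<Omega> M k"
    "\<And>t. t \<in> {0..\<tau>} \<Longrightarrow> ((\<lambda>s. wg_norm M (u s - u t)) \<longlongrightarrow> 0) (at t within {0..\<tau>})"
  using assms unfolding H1_time_def by blast+

lemma Vh_functional_continuous:
  assumes L: "Vh_functional M k L" and u: "H1_time \<tau> \<Omega> M k u w"
  shows "continuous_on {0..\<tau>} (\<lambda>t. L (u t))"
  unfolding continuous_on_def
proof
  fix t assume t: "t \<in> {0..\<tau>}"
  obtain C where C: "\<And>v. v \<in> Vh M k \<Longrightarrow> \<bar>L v\<bar> \<le> C * wg_norm M v"
    using L unfolding Vh_functional_def by blast
  note uV = Vh0_subset[OF H1_timeD(4)[OF u]]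
  have "\<bar>L (u s) - L (u t)\<bar> \<le> C * wg_norm M (u s - u t)" if "s \<in> {0..\<tau>}" for s
    using C[OF Vh_diff[OF uV[OF that] uV[OF t]]] Vh_functional_diff[OF L uV[OF that] uV[OF t]] by simp
  then have "eventually (\<lambda>s. norm (L (u s) - L (u t)) \<le> C * wg_norm M (u s - u t)) (at t within {0..\<tau>})"
    by (auto simp: eventually_at_filter)
  moreover have "((\<lambda>s. C * wg_norm M (u s - u t)) \<longlongrightarrow> 0) (at t within {0..\<tau>})"
    using tendsto_mult_left[OF H1_timeD(5)[OF u t], of C] by simp
  ultimately have "((\<lambda>s. L (u s) - L (u t)) \<longlongrightarrow> 0) (at t within {0..\<tau>})"
    by (rule Lim_null_comparison)
  then show "((\<lambda>s. L (u s)) \<longlongrightarrow> L (u t)) (at t within {0..\<tau>})" by (simp add: LIM_zero_iff)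
qed

definition time_test_function :: "real \<Rightarrow> (real \<Rightarrow> real) \<Rightarrow> (real \<Rightarrow> real) \<Rightarrow> bool" where
  "time_test_function \<tau> \<phi> \<phi>' \<longleftrightarrow>
     (\<forall>t. (\<phi> has_real_derivative \<phi>' t) (at t)) \<and> continuous_on UNIV \<phi>' \<and>
     (\<exists>a b. 0 < a \<and> b < \<tau> \<and> (\<forall>t. t \<notin> {a..b} \<longrightarrow> \<phi> t = 0))"

text \<open>The weak time derivative is given by the values at the points \<open>x\<close>. Expanding these values in the
  basis shows that the defects \<open>A b\<close> of the coordinates satisfy \<open>\<Sum>b. A b * b x = 0\<close> for all \<open>x\<close>, and taking
  the inner product with a basis function isolates one defect.\<close>

lemma coordinate_weak_derivative:
  assumes M: "is_mesh \<Omega> M" "T \<in> cells M" and u: "H1_time \<tau> \<Omega> M k u w"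
    and B: "orthonormal_basis (lebesgue_on T) (poly_space k) B" and b: "b \<in> B"
    and \<phi>: "time_test_function \<tau> \<phi> \<phi>'"
  shows "(LINT t|lebesgue_on {0<..<\<tau>}. L2_ip (lebesgue_on T) (v0 (u t) T) b * \<phi>' t)
    = - (LINT t|lebesgue_on {0<..<\<tau>}. L2_ip (lebesgue_on T) (v0 (w t) T) b * \<phi> t)"
proof -
  let ?m = "lebesgue_on {0<..<\<tau>}"
  let ?c = "\<lambda>v b. L2_ip (lebesgue_on T) (v0 v T) b"
  note Bd = orthonormal_basisD[OF B]
  note PL2 = poly_space_L2_cell[OF M]
  have \<phi>'_cont: "continuous_on {0..\<tau>} \<phi>'"
    using \<phi> continuous_on_subset unfolding time_test_function_def by blast
  have \<phi>_cont: "continuous_on {0..\<tau>} \<phi>"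
    using \<phi> unfolding time_test_function_def
    by (intro continuous_at_imp_continuous_on) (meson DERIV_isCont)
  have pointwise: "(LINT t|?m. v0 (y t) T x * \<eta> t) = (\<Sum>b\<in>B. (LINT t|?m. ?c (y t) b * \<eta> t) * b x)"
    if y: "bochner_L2 \<tau> (Vh0 \<Omega> M k) (wg_norm M) y" and \<eta>: "continuous_on {0..\<tau>} \<eta>"
    for y \<eta> x
  proof -
    have I: "integrable ?m (\<lambda>t. ?c (y t) b * \<eta> t)" if "b \<in> B" for b
      using that Bd(2) PL2
      by (intro Vh_functional_bochner_integrable[OF Vh_functional_components(1)[OF M, of b k] y \<eta>]) auto
    have I': "integrable ?m (\<lambda>t. \<Sum>b\<in>B. ?c (y t) b * \<eta> t * b x)"
      by (intro Bochner_Integration.integrable_sum integrable_mult_left I)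
    have "AE t in ?m. y t \<in> Vh0 \<Omega> M k" using y by (simp add: bochner_L2_def)
    then have ae: "AE t in ?m. (\<Sum>b\<in>B. ?c (y t) b * \<eta> t * b x) = v0 (y t) T x * \<eta> t"
    proof eventually_elim
      case (elim t)
      have "v0 (y t) T x = (\<Sum>b\<in>B. ?c (y t) b * b x)"
        using fun_cong[OF Bd(4)[OF VhD(1)[OF Vh0_subset[OF elim] M(2)]]] .
      then show ?case by (simp add: sum_distrib_left mult_ac)
    qed
    have "(LINT t|?m. v0 (y t) T x * \<eta> t) = (LINT t|?m. (\<Sum>b\<in>B. ?c (y t) b * \<eta> t * b x))"
      using borel_measurable_lebesgue_on_AE[OF _ borel_measurable_integrable[OF I'] ae] I' ae
      by (intro integral_cong_AE) (auto elim: eventually_mono)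
    also have "\<dots> = (\<Sum>b\<in>B. (LINT t|?m. ?c (y t) b * \<eta> t) * b x)"
      using I by (subst Bochner_Integration.integral_sum) auto
    finally show ?thesis .
  qed
  define A where "A b = (LINT t|?m. ?c (u t) b * \<phi>' t) + (LINT t|?m. ?c (w t) b * \<phi> t)" for b
  have "(\<Sum>b\<in>B. A b * b x) = 0" for x
  proof -
    have "(LINT t|?m. v0 (u t) T x * \<phi>' t) = - (LINT t|?m. v0 (w t) T x * \<phi> t)"
      using H1_timeD(3)[OF u, unfolded weak_time_deriv_def, rule_format,
        OF \<phi>[unfolded time_test_function_def]] by simp
    then show ?thesis
      using pointwise[OF H1_timeD(1)[OF u] \<phi>'_cont] pointwise[OF H1_timeD(2)[OF u] \<phi>_cont]
      by (simp add: A_def distrib_right sum.distrib)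
  qed
  then have "0 = L2_ip (lebesgue_on T) (\<lambda>x. \<Sum>b\<in>B. A b * b x) b" by simp
  also have "\<dots> = (\<Sum>b'\<in>B. A b' * L2_ip (lebesgue_on T) b' b)"
    using Bd(2) PL2 b by (intro L2_ip_sum) auto
  also have "\<dots> = (\<Sum>b'\<in>B. if b' = b then A b else 0)"
    by (intro sum.cong) (auto simp: Bd(3) b)
  also have "\<dots> = A b" using Bd(1) b by simp
  finally show ?thesis by (simp add: A_def)
qed

section \<open>Energy estimate and uniqueness\<close>

text \<open>The discrete equations of two solutions with the common right-hand side eliminated; \<open>w1\<close> and \<open>w2\<close> are
  the weak time derivatives of \<open>u1\<close> and \<open>u2\<close>.\<close>

definition same_weak_equation ::
    "real \<Rightarrow> (real^'n::finite) set \<Rightarrow> (real^'n) mesh \<Rightarrow> nat \<Rightarrow> nat \<Rightarrow> (real \<Rightarrow> (real^'n) wg) \<Rightarrow>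
     (real \<Rightarrow> (real^'n) wg) \<Rightarrow> (real \<Rightarrow> (real^'n) wg) \<Rightarrow> (real \<Rightarrow> (real^'n) wg) \<Rightarrow> bool" where
  "same_weak_equation \<tau> \<Omega> M k r u1 w1 u2 w2 \<longleftrightarrow>
     (AE t in lebesgue_on {0<..<\<tau>}. \<forall>v\<in>Vh0 \<Omega> M k.
        (\<Sum>T\<in>cells M. L2_ip (lebesgue_on T) (v0 (w1 t) T) (v0 v T)) + wg_form M r (u1 t) v
        = (\<Sum>T\<in>cells M. L2_ip (lebesgue_on T) (v0 (w2 t) T) (v0 v T)) + wg_form M r (u2 t) v)"

lemma solutions_same_weak_equation:
  assumes "semidiscrete_solution \<tau> \<Omega> M k r f \<psi> u1" "semidiscrete_solution \<tau> \<Omega> M k r f \<psi> u2"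
  obtains w1 w2 where "H1_time \<tau> \<Omega> M k u1 w1" "H1_time \<tau> \<Omega> M k u2 w2" "u1 0 = u2 0"
    "same_weak_equation \<tau> \<Omega> M k r u1 w1 u2 w2"
proof -
  let ?rhs = "\<lambda>t v. \<Sum>T\<in>cells M. L2_ip (lebesgue_on T) (f t) (v0 v T)"
  let ?lhs = "\<lambda>u w t v. (\<Sum>T\<in>cells M. L2_ip (lebesgue_on T) (v0 (w t) T) (v0 v T)) + wg_form M r (u t) v"
  obtain w1 w2 where w: "H1_time \<tau> \<Omega> M k u1 w1" "H1_time \<tau> \<Omega> M k u2 w2"
      "u1 0 = Qh \<Omega> M k \<psi>" "u2 0 = Qh \<Omega> M k \<psi>"
    and ae: "AE t in lebesgue_on {0<..\<tau>}. \<forall>v\<in>Vh0 \<Omega> M k. ?lhs u1 w1 t v = ?rhs t v"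
      "AE t in lebesgue_on {0<..\<tau>}. \<forall>v\<in>Vh0 \<Omega> M k. ?lhs u2 w2 t v = ?rhs t v"
    using assms unfolding semidiscrete_solution_def by blast
  have "AE t in lebesgue_on {0<..\<tau>}. \<forall>v\<in>Vh0 \<Omega> M k. ?lhs u1 w1 t v = ?lhs u2 w2 t v"
    using ae by eventually_elim simp
  then have "AE t in lebesgue. t \<in> {0<..\<tau>} \<longrightarrow> (\<forall>v\<in>Vh0 \<Omega> M k. ?lhs u1 w1 t v = ?lhs u2 w2 t v)"
    by (simp add: AE_restrict_space_iff)
  then have "AE t in lebesgue. t \<in> {0<..<\<tau>} \<longrightarrow> (\<forall>v\<in>Vh0 \<Omega> M k. ?lhs u1 w1 t v = ?lhs u2 w2 t v)"
    by (rule eventually_mono) auto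
  then have "same_weak_equation \<tau> \<Omega> M k r u1 w1 u2 w2"
    by (simp add: same_weak_equation_def AE_restrict_space_iff)
  then show thesis using that w by simp
qed

text \<open>Testing with \<open>cell_function T b\<close> leaves only the coordinate along \<open>b\<close> of the time derivatives in the
  equation. So the weak derivative of this coordinate of \<open>u1 - u2\<close> agrees almost everywhere with a
  continuous function of time, and the derivative is a classical one.\<close>

lemma coordinate_has_derivative:
  assumes M: "is_mesh \<Omega> M" "T \<in> cells M"
    and u1: "H1_time \<tau> \<Omega> M k u1 w1" and u2: "H1_time \<tau> \<Omega> M k u2 w2"
    and eqn: "same_weak_equation \<tau> \<Omega> M k r u1 w1 u2 w2"
    and B: "orthonormal_basis (lebesgue_on T) (poly_space k) B" and b: "b \<in> B"
    and s: "0 < s" "s < \<tau>"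
  shows "((\<lambda>t. L2_ip (lebesgue_on T) (v0 (u1 t - u2 t) T) b) has_real_derivative
    - wg_form M r (u1 s - u2 s) (cell_function T b)) (at s)"
proof -
  let ?m = "lebesgue_on {0<..<\<tau>}"
  let ?c = "\<lambda>v. L2_ip (lebesgue_on T) (v0 v T) b"
  let ?q = "cell_function T b"
  let ?a = "\<lambda>v. wg_form M r v ?q"
  have bk: "b \<in> poly_space k" using orthonormal_basisD(2)[OF B] b by blast
  have bL2: "b \<in> L2 (lebesgue_on T)" using bk poly_space_L2_cell[OF M] by blast
  have q: "?q \<in> Vh0 \<Omega> M k" by (rule cell_function_Vh0[OF M(2) bk])
  have c: "Vh_functional M k ?c" by (rule Vh_functional_components(1)[OF M bL2])
  have a: "Vh_functional M k ?a" by (rule Vh_functional_wg_form[OF M(1) Vh0_subset[OF q]])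
  have V: "u1 t \<in> Vh M k" "u2 t \<in> Vh M k" if "t \<in> {0..\<tau>}" for t
    using Vh0_subset H1_timeD(4)[OF u1 that] H1_timeD(4)[OF u2 that] by blast+
  have c_diff: "?c (u1 t - u2 t) = ?c (u1 t) - ?c (u2 t)" if "t \<in> {0..\<tau>}" for t
    using Vh_functional_diff[OF c] V[OF that] by blast
  have a_diff: "?a (u1 t - u2 t) = ?a (u1 t) - ?a (u2 t)" if "t \<in> {0..\<tau>}" for t
    using Vh_functional_diff[OF a] V[OF that] by blast
  have cell_sum: "(\<Sum>S\<in>cells M. L2_ip (lebesgue_on S) (v0 v S) (v0 ?q S)) = ?c v" for v
  proof -
    have "(\<Sum>S\<in>cells M. L2_ip (lebesgue_on S) (v0 v S) (v0 ?q S)) = (\<Sum>S\<in>cells M. if S = T then ?c v else 0)"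
      by (intro sum.cong) auto
    then show ?thesis using M(2) is_meshD(1)[OF M(1)] by simp
  qed
  have "AE t in ?m. ?c (w1 t) + ?a (u1 t) = ?c (w2 t) + ?a (u2 t)"
    using eqn[unfolded same_weak_equation_def]
    by (rule eventually_mono) (drule bspec[OF _ q], simp only: cell_sum)
  then have ae: "AE t in ?m. ?c (w1 t) - ?c (w2 t) = - (?a (u1 t) - ?a (u2 t))"
    by (rule eventually_mono) simp
  have "((\<lambda>t. ?c (u1 t) - ?c (u2 t)) has_real_derivative - (?a (u1 s) - ?a (u2 s))) (at s)"
  proof (rule du_Bois_Reymond[OF _ _ _ s])
    show "continuous_on {0..\<tau>} (\<lambda>t. ?c (u1 t) - ?c (u2 t))"
      by (intro continuous_intros Vh_functional_continuous[OF c u1] Vh_functional_continuous[OF c u2])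
    show "continuous_on {0..\<tau>} (\<lambda>t. - (?a (u1 t) - ?a (u2 t)))"
      by (intro continuous_intros Vh_functional_continuous[OF a u1] Vh_functional_continuous[OF a u2])
    fix \<phi> \<phi>' :: "real \<Rightarrow> real"
    assume d: "\<forall>t. (\<phi> has_real_derivative \<phi>' t) (at t)" and \<phi>': "continuous_on UNIV \<phi>'"
      and "\<exists>a b. 0 < a \<and> b < \<tau> \<and> (\<forall>t. t \<notin> {a..b} \<longrightarrow> \<phi> t = 0)"
    then have test: "time_test_function \<tau> \<phi> \<phi>'" by (simp add: time_test_function_def)
    have \<phi>'_cont: "continuous_on {0..\<tau>} \<phi>'" using \<phi>' by (rule continuous_on_subset) simp
    have \<phi>_cont: "continuous_on {0..\<tau>} \<phi>"
      using d by (intro continuous_at_imp_continuous_on) (meson DERIV_isCont)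
    note I = Vh_functional_bochner_integrable
    note Iu = I[OF c H1_timeD(1)[OF u1] \<phi>'_cont] I[OF c H1_timeD(1)[OF u2] \<phi>'_cont]
    note Iw = I[OF c H1_timeD(2)[OF u1] \<phi>_cont] I[OF c H1_timeD(2)[OF u2] \<phi>_cont]
    note Ia = I[OF a H1_timeD(1)[OF u1] \<phi>_cont] I[OF a H1_timeD(1)[OF u2] \<phi>_cont]
    have "(LINT t|?m. (?c (u1 t) - ?c (u2 t)) * \<phi>' t)
        = (LINT t|?m. ?c (u1 t) * \<phi>' t) - (LINT t|?m. ?c (u2 t) * \<phi>' t)"
      using Iu by (simp add: left_diff_distrib)
    also have "\<dots> = - ((LINT t|?m. ?c (w1 t) * \<phi> t) - (LINT t|?m. ?c (w2 t) * \<phi> t))"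
      using coordinate_weak_derivative[OF M u1 B b test] coordinate_weak_derivative[OF M u2 B b test]
      by simp
    also have "(LINT t|?m. ?c (w1 t) * \<phi> t) - (LINT t|?m. ?c (w2 t) * \<phi> t)
        = (LINT t|?m. ?c (w1 t) * \<phi> t - ?c (w2 t) * \<phi> t)"
      using Iw by simp
    also have "\<dots> = (LINT t|?m. - (?a (u1 t) * \<phi> t - ?a (u2 t) * \<phi> t))"
    proof (rule integral_cong_AE)
      show "(\<lambda>t. ?c (w1 t) * \<phi> t - ?c (w2 t) * \<phi> t) \<in> borel_measurable ?m"
          "(\<lambda>t. - (?a (u1 t) * \<phi> t - ?a (u2 t) * \<phi> t)) \<in> borel_measurable ?m"
        using Iw Ia by (auto intro!: borel_measurable_diff borel_measurable_uminus borel_measurable_integrable)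
      show "AE t in ?m. ?c (w1 t) * \<phi> t - ?c (w2 t) * \<phi> t = - (?a (u1 t) * \<phi> t - ?a (u2 t) * \<phi> t)"
        using ae
      proof eventually_elim
        case (elim t)
        then show ?case
          by (simp only: left_diff_distrib[symmetric] mult_minus_left[symmetric])
      qed
    qed
    also have "(\<lambda>t. - (?a (u1 t) * \<phi> t - ?a (u2 t) * \<phi> t)) = (\<lambda>t. - (?a (u1 t) - ?a (u2 t)) * \<phi> t)"
      by (simp add: fun_eq_iff left_diff_distrib)
    finally show "(LINT t|?m. (?c (u1 t) - ?c (u2 t)) * \<phi>' t)
        = - (LINT t|?m. - (?a (u1 t) - ?a (u2 t)) * \<phi> t)" .
  qed
  then have "((\<lambda>t. ?c (u1 t) - ?c (u2 t)) has_real_derivative - ?a (u1 s - u2 s)) (at s)"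
    using a_diff[of s] s by simp
  then show ?thesis
    by (rule has_field_derivative_transform_within_open[where S = "{0<..<\<tau>}"])
       (use s in \<open>auto simp: c_diff\<close>)
qed

text \<open>A test function without interior component does not see the time derivative. The form therefore
  vanishes for almost every time, and by continuity for every time.\<close>

lemma wg_form_face_component_zero:
  assumes \<tau>: "\<tau> > 0" and M: "is_mesh \<Omega> M"
    and u1: "H1_time \<tau> \<Omega> M k u1 w1" and u2: "H1_time \<tau> \<Omega> M k u2 w2"
    and eqn: "same_weak_equation \<tau> \<Omega> M k r u1 w1 u2 w2"
    and v: "v \<in> Vh0 \<Omega> M k" and t: "t \<in> {0..\<tau>}"
  shows "wg_form M r (u1 t - u2 t) (face_component v) = 0"
proof -
  let ?a = "\<lambda>u. wg_form M r u (face_component v)"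
  note f = face_component_Vh0[OF v]
  have a: "Vh_functional M k ?a" by (rule Vh_functional_wg_form[OF M Vh0_subset[OF f]])
  have "AE s in lebesgue_on {0<..<\<tau>}. ?a (u1 s) - ?a (u2 s) = 0"
    using eqn unfolding same_weak_equation_def
  proof (rule eventually_mono)
    fix s
    assume "\<forall>v\<in>Vh0 \<Omega> M k.
        (\<Sum>T\<in>cells M. L2_ip (lebesgue_on T) (v0 (w1 s) T) (v0 v T)) + wg_form M r (u1 s) v
        = (\<Sum>T\<in>cells M. L2_ip (lebesgue_on T) (v0 (w2 s) T) (v0 v T)) + wg_form M r (u2 s) v"
    from bspec[OF this f] show "?a (u1 s) - ?a (u2 s) = 0" by simp
  qed
  then have "?a (u1 t) - ?a (u2 t) = 0"
    by (rule continuous_AE_zero_imp_zero[OF \<tau> _ _ t, rotated])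
       (intro continuous_intros Vh_functional_continuous[OF a u1] Vh_functional_continuous[OF a u2])
  then show ?thesis
    using Vh_functional_diff[OF a] Vh0_subset H1_timeD(4)[OF u1 t] H1_timeD(4)[OF u2 t] by metis
qed

text \<open>\<open>E\<close> is the squared \<open>L\<^sup>2\<close> norm of the interior component of \<open>u1 - u2\<close>, written in coordinates. Its
  derivative is \<open>- 2 |||u1 - u2|||\<^sup>2 \<le> 0\<close> and it starts at zero, so it vanishes identically. With all the
  coordinates zero, the expansion of the energy in terms of them vanishes as well.\<close>

lemma energy_argument:
  assumes \<tau>: "\<tau> > 0" and M: "is_mesh \<Omega> M"
    and u1: "H1_time \<tau> \<Omega> M k u1 w1" and u2: "H1_time \<tau> \<Omega> M k u2 w2"
    and init: "u1 0 = u2 0"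
    and eqn: "same_weak_equation \<tau> \<Omega> M k r u1 w1 u2 w2"
  shows "\<And>t T. t \<in> {0..\<tau>} \<Longrightarrow> T \<in> cells M \<Longrightarrow> v0 (u1 t - u2 t) T = (\<lambda>x. 0)"
    and "\<And>t. t \<in> {0<..<\<tau>} \<Longrightarrow> wg_form M r (u1 t - u2 t) (u1 t - u2 t) = 0"
proof -
  define D where "D t = u1 t - u2 t" for t
  have "\<forall>T\<in>cells M. \<exists>B. orthonormal_basis (lebesgue_on T) (poly_space k) B"
    using poly_space_orthonormal_basis[OF M] by blast
  from bchoice[OF this] obtain B where
    B: "\<And>T. T \<in> cells M \<Longrightarrow> orthonormal_basis (lebesgue_on T) (poly_space k) (B T)" by blast
  define c where "c T b t = L2_ip (lebesgue_on T) (v0 (D t) T) b" for T b t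
  define E where "E t = (\<Sum>T\<in>cells M. \<Sum>b\<in>B T. (c T b t)\<^sup>2)" for t
  have DV0: "D t \<in> Vh0 \<Omega> M k" if "t \<in> {0..\<tau>}" for t
    unfolding D_def by (intro Vh0_diff H1_timeD(4)[OF u1 that] H1_timeD(4)[OF u2 that])
  have bL2: "b \<in> L2 (lebesgue_on T)" if "T \<in> cells M" "b \<in> B T" for T b
    using orthonormal_basisD(2)[OF B[OF that(1)]] poly_space_L2_cell[OF M that(1)] that(2) by blast
  have c_cont: "continuous_on {0..\<tau>} (c T b)" if T: "T \<in> cells M" "b \<in> B T" for T b
  proof -
    let ?c = "\<lambda>v. L2_ip (lebesgue_on T) (v0 v T) b"
    have L: "Vh_functional M k ?c" by (rule Vh_functional_components(1)[OF M T(1) bL2[OF T]])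
    have c_eq: "c T b t = ?c (u1 t) - ?c (u2 t)" if "t \<in> {0..\<tau>}" for t
      unfolding c_def D_def
      using Vh_functional_diff[OF L] Vh0_subset H1_timeD(4)[OF u1 that] H1_timeD(4)[OF u2 that] by blast
    have "continuous_on {0..\<tau>} (\<lambda>t. ?c (u1 t) - ?c (u2 t))"
      by (intro continuous_intros Vh_functional_continuous[OF L u1] Vh_functional_continuous[OF L u2])
    then show ?thesis using c_eq by (subst continuous_on_cong[OF refl]) auto
  qed
  have energy: "wg_form M r (D t) (D t)
      = (\<Sum>T\<in>cells M. \<Sum>b\<in>B T. c T b t * wg_form M r (D t) (cell_function T b))"
    if t: "t \<in> {0..\<tau>}" for t
    using wg_form_split[OF M Vh0_subset[OF DV0[OF t]] DV0[OF t] B]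
      wg_form_face_component_zero[OF \<tau> M u1 u2 eqn DV0[OF t] t]
    by (simp add: c_def flip: D_def)
  have deriv: "(E has_real_derivative - 2 * wg_form M r (D t) (D t)) (at t)" if t: "0 < t" "t < \<tau>" for t
  proof -
    have "(c T b has_real_derivative - wg_form M r (D t) (cell_function T b)) (at t)"
      if "T \<in> cells M" "b \<in> B T" for T b
      unfolding c_def[abs_def] D_def
      by (rule coordinate_has_derivative[OF M that(1) u1 u2 eqn B[OF that(1)] that(2) t])
    then have "(E has_real_derivative
        (\<Sum>T\<in>cells M. \<Sum>b\<in>B T. 2 * c T b t * (- wg_form M r (D t) (cell_function T b)))) (at t)"
      unfolding E_def[abs_def]
      by (intro DERIV_sum) (auto intro!: derivative_eq_intros)
    moreover have "(\<Sum>T\<in>cells M. \<Sum>b\<in>B T. 2 * c T b t * (- wg_form M r (D t) (cell_function T b)))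
        = - 2 * wg_form M r (D t) (D t)"
      using t by (simp add: energy sum_distrib_left sum_negf mult.assoc)
    ultimately show ?thesis by simp
  qed
  have E_cont: "continuous_on {0..\<tau>} E"
    unfolding E_def[abs_def] by (intro continuous_intros c_cont)
  have "D 0 = 0" using init by (simp add: D_def)
  then have "v0 (D 0) T = (\<lambda>x. 0)" for T by (simp add: v0_def zero_fun_def)
  then have E0: "E 0 = 0" by (simp add: E_def c_def)
  have c_zero: "c T b t = 0" if t: "t \<in> {0..\<tau>}" and T: "T \<in> cells M" and b: "b \<in> B T" for t T b
  proof -
    have "E t \<le> E 0"
    proof (rule DERIV_nonpos_imp_decreasing_open[of 0 t E])
      show "0 \<le> t" using t by simp
      show "\<exists>y. (E has_real_derivative y) (at s) \<and> y \<le> 0" if "0 < s" "s < t" for s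
        using deriv[of s] wg_form_self_nonneg[of M r "D s"] that t by auto
      show "continuous_on {0..t} E" using t by (intro continuous_on_subset[OF E_cont]) auto
    qed
    moreover have "0 \<le> E t" unfolding E_def by (intro sum_nonneg) simp
    ultimately have "E t = 0" using E0 by simp
    then have "(\<Sum>b\<in>B T. (c T b t)\<^sup>2) = 0"
      unfolding E_def using T is_meshD(1)[OF M] by (subst (asm) sum_nonneg_eq_0_iff) (auto intro: sum_nonneg)
    then have "(c T b t)\<^sup>2 = 0"
      using b orthonormal_basisD(1)[OF B[OF T]] by (subst (asm) sum_nonneg_eq_0_iff) auto
    then show ?thesis by simp
  qed
  show "v0 (u1 t - u2 t) T = (\<lambda>x. 0)" if t: "t \<in> {0..\<tau>}" and T: "T \<in> cells M" for t T
  proof -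
    have "v0 (D t) T = (\<lambda>x. \<Sum>b\<in>B T. c T b t * b x)"
      unfolding c_def by (rule orthonormal_basisD(4)[OF B[OF T] VhD(1)[OF Vh0_subset[OF DV0[OF t]] T]])
    then show ?thesis using c_zero[OF t T] by (simp add: D_def)
  qed
  show "wg_form M r (u1 t - u2 t) (u1 t - u2 t) = 0" if "t \<in> {0<..<\<tau>}" for t
    using energy[of t] c_zero[of t] that by (simp add: D_def)
qed

text \<open>Pairing each component of the difference at time \<open>t\<close> with itself gives a bounded functional of the
  solution at all times, which is continuous in time; this carries the result to the end points.\<close>

lemma difference_zero_on_closed_interval:
  assumes \<tau>: "\<tau> > 0" and M: "is_mesh \<Omega> M"
    and u1: "H1_time \<tau> \<Omega> M k u1 w1" and u2: "H1_time \<tau> \<Omega> M k u2 w2"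
    and zero: "\<And>s. s \<in> {0<..<\<tau>} \<Longrightarrow> u1 s - u2 s = 0" and t: "t \<in> {0..\<tau>}"
  shows "u1 t = u2 t"
proof -
  let ?v = "u1 t - u2 t"
  have uV: "u1 s \<in> Vh M k" "u2 s \<in> Vh M k" if "s \<in> {0..\<tau>}" for s
    using Vh0_subset H1_timeD(4)[OF u1 that] H1_timeD(4)[OF u2 that] by blast+
  have v: "?v \<in> Vh M k" by (intro Vh_diff uV t)
  have L0: "L ?v = 0" if L: "Vh_functional M k L" for L
  proof -
    have "L (u1 s) - L (u2 s) = 0" if "s \<in> {0<..<\<tau>}" for s
      using zero[OF that] that by simp
    then have "AE s in lebesgue_on {0<..<\<tau>}. L (u1 s) - L (u2 s) = 0"
      by (intro AE_I2) (simp add: space_restrict_space)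
    then have "L (u1 t) - L (u2 t) = 0"
      by (rule continuous_AE_zero_imp_zero[OF \<tau> _ _ t, rotated])
         (intro continuous_intros Vh_functional_continuous[OF L u1] Vh_functional_continuous[OF L u2])
    then show ?thesis using Vh_functional_diff[OF L] uV[OF t] by simp
  qed
  note L2v = Vh_L2[OF M v]
  have "?v = 0"
  proof (rule Vh_eq_zero[OF v])
    show "v0 ?v T = (\<lambda>x. 0)" if T: "T \<in> cells M" for T
    proof (rule poly_space_definite_cell[OF M T VhD(1)[OF v T]])
      show "L2_norm (lebesgue_on T) (v0 ?v T) = 0"
        using L0[OF Vh_functional_components(1)[OF M T L2v(1)[OF T]]] by (simp flip: L2_norm_square)
    qed
    show "vb ?v e = (\<lambda>x. 0)" if e: "e \<in> faces M" for e
    proof (rule P_face_definite[OF M e VhD(2)[OF v e]])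
      show "L2_norm (fmeas M e) (vb ?v e) = 0"
        using L0[OF Vh_functional_components(2)[OF M e L2v(2)[OF e]]] by (simp flip: L2_norm_square)
    qed
    show "vn ?v e = (\<lambda>x. 0)" if e: "e \<in> faces M" for e
    proof (rule P_face_definite[OF M e VhD(3)[OF v e]])
      show "L2_norm (fmeas M e) (vn ?v e) = 0"
        using L0[OF Vh_functional_components(3)[OF M e L2v(3)[OF e]]] by (simp flip: L2_norm_square)
    qed
  qed
  then show ?thesis by simp
qed

theorem theorem3p7:
  fixes \<Omega> :: "(real^'n::finite) set"
    and MM :: "(real^'n) mesh set" and M :: "(real^'n) mesh"
    and k r :: nat and tbar :: real
    and f :: "real \<Rightarrow> real^'n \<Rightarrow> real" and \<psi> :: "real^'n \<Rightarrow> real"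
    and u1 u2 :: "real \<Rightarrow> (real^'n) wg"
  assumes "CARD('n) = 2 \<or> CARD('n) = 3"
    and "polyhedral_domain \<Omega>"
    and "tbar > 0"
    and "bochner_L2 tbar (L2 (lebesgue_on \<Omega>)) (L2_norm (lebesgue_on \<Omega>)) f"
    and "\<psi> \<in> H02 \<Omega>"
    and "k \<ge> 2"
    and "shape_regular_family \<Omega> MM"
    and "norm_equivalence MM k r"
    and "M \<in> MM"
    and "semidiscrete_solution tbar \<Omega> M k r f \<psi> u1"
    and "semidiscrete_solution tbar \<Omega> M k r f \<psi> u2"
  shows "\<forall>t\<in>{0..tbar}. u1 t = u2 t"
proof
  fix t assume t: "t \<in> {0..tbar}"
  have M: "is_mesh \<Omega> M" using assms(7,9) unfolding shape_regular_family_def by blast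
  obtain w1 w2 where u1: "H1_time tbar \<Omega> M k u1 w1" and u2: "H1_time tbar \<Omega> M k u2 w2"
    and init: "u1 0 = u2 0" and eqn: "same_weak_equation tbar \<Omega> M k r u1 w1 u2 w2"
    using solutions_same_weak_equation[OF assms(10,11)] .
  note energy = energy_argument[OF assms(3) M u1 u2 init eqn]
  have "u1 s - u2 s = 0" if s: "s \<in> {0<..<tbar}" for s
  proof -
    let ?v = "u1 s - u2 s"
    have s': "s \<in> {0..tbar}" using s by simp
    have v: "?v \<in> Vh M k"
      by (intro Vh_diff Vh0_subset[OF H1_timeD(4)[OF u1 s']] Vh0_subset[OF H1_timeD(4)[OF u2 s']])
    have "energy_norm M r ?v = 0" using energy(2)[OF s] by (simp add: energy_norm_def)
    moreover obtain C where "C > 0" "C * norm_2h M ?v \<le> energy_norm M r ?v"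
      using assms(8,9) v unfolding norm_equivalence_def by blast
    moreover have "0 \<le> norm_2h M ?v"
      unfolding norm_2h_def
      by (intro real_sqrt_ge_zero sum_nonneg add_nonneg_nonneg divide_nonneg_nonneg)
         (auto intro!: sum_nonneg less_imp_le cells_diameter_pos[OF M])
    ultimately have "norm_2h M ?v = 0" by (simp add: mult_le_0_iff)
    from norm_2h_definite[OF M v energy(1)[OF s'] this]
    show ?thesis by (intro Vh_eq_zero[OF v energy(1)[OF s']]) blast+
  qed
  then show "u1 t = u2 t" by (rule difference_zero_on_closed_interval[OF assms(3) M u1 u2 _ t])
qed

end
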